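(* Fix $k\ge1$ and run the PAGD method (described in the context) for $T$ iterations, where $T$ is any integer with $$T\ \ge\ \frac{\log\Big(1+9\sqrt2\,L_l^{3/2}\sigma_l^{-3/2}(\sigma_lc^2+1)^2\Big)}{\log\Big(1+\sqrt{\frac{\sigma_l}{2L_l}}\Big)}.$$ Then the returned point $\hat z_k\in\mathcal X$ satisfies, for all $z\in\mathcal X$, $$a_k\Big\langle\nabla g(\hat x_{k-1})+Qz_{k-1}+\Big(Q+\frac2{a_k}I\Big)(\hat z_k-z_{k-1}),\ \hat z_k-z\Big\rangle-\frac12\Big(\|\hat z_k-z_{k-1}\|^2+\|\hat z_k-z\|^2\Big)\le0.$$ Moreover, the right-hand side of the lower bound on $T$ is $\tilde O\big(\frac{\sigma_{\max}}{\sigma_{\min}}\log k\big)$ for $k\ge2$, where $\tilde O$ hides a multiplicative factor independent of $k$ and bounded by a polynomial in $1+|\log\sigma_{\min}|$, $1+|\log\sigma_{\max}|$, $1+|\log L|$.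
   Context: Setting. $\|\cdot\|$ is the Euclidean norm. $\mathcal V\subset\mathbb R^n$ is a nonempty closed convex set, $\mathcal X=\mathbb R^d\times\mathcal V$, $x=(w,v)\in\mathcal X$; $f$ on $\mathbb R^d$ and $h$ on $\mathcal V$ are convex and differentiable, $g(x)=f(w)+h(v)$. For all $x,y\in\mathcal X$: $g(x)\ge g(y)+\langle\nabla g(y),x-y\rangle$ and $\|\nabla g(x)-\nabla g(y)\|\le L\|x-y\|$, with $L>0$. $A\in\mathbb R^{d\times n}$ has full column rank with least and largest singular values $\sigma_{\min}>0$, $\sigma_{\max}>0$. $Q=\begin{pmatrix}0&A\\-A^T&0\end{pmatrix}$. Let $k\ge1$ be an integer, $A_k=\frac{k^2}{4L}$, $a_k=A_k-A_{k-1}=\frac{2k-1}{4L}$, and let $\hat x_{k-1},z_{k-1}\in\mathcal X$ be given points (iterates of an outer algorithm; they are constants for the subproblem). PAGD method. Put $c=a_k$, $(w^0,v^0)=\nabla g(\hat x_{k-1})+Qz_{k-1}$, $(w^1,v^1)=z_{k-1}$ (block decomposition in $\mathbb R^d\times\mathbb R^n$), $L_l=\sigma_{\max}^2+\frac4{c^2}$, $\sigma_l=\sigma_{\min}^2+\frac4{c^2}$, and $l(v)=\frac12(v-v^1)^T(A^TA+\frac4{c^2}I)(v-v^1)+(\frac2cv^0+A^Tw^0)^T(v-v^1)$ for $v\in\mathcal V$. Let $B_0=0$, $B_1=\frac1{2L_l}$, $B_t=B_1(1+\sqrt{\sigma_l/(2L_l)})^{t-1}$ for $t\ge1$, $b_t=B_t-B_{t-1}$.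 Start with $v_0=u_0=v^1$. For $t=1,\dots,T$: $\hat v_{t-1}=\frac{B_{t-1}}{B_t}v_{t-1}+\frac{b_t}{B_t}u_{t-1}$; $v_t=\arg\min_{v\in\mathcal V}\{\langle\nabla l(\hat v_{t-1}),v\rangle+L_l\|v-\hat v_{t-1}\|^2\}$; $u_t=\arg\min_{u\in\mathcal V}\varphi_t(u)$ with $\varphi_t(u)=\sum_{i=1}^tb_i(l(\hat v_{i-1})+\langle\nabla l(\hat v_{i-1}),u-\hat v_{i-1}\rangle+\frac{\sigma_l}2\|u-\hat v_{i-1}\|^2)+\frac12\|u-v_0\|^2$. Finally let $\tilde v$ be a $v_t$, $t\in\{1,\dots,T\}$, with minimal $\|v_t-\hat v_{t-1}\|$; let $\tilde w=w^1-\frac c2(w^0+A(\tilde v-v^1))$; return $\hat z_k=(\tilde w,\tilde v)$. *)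

theory Defs
  imports "HOL-Analysis.Analysis"
begin

text \<open>
  The space R^d x R^n is the product type \<open>(real^'d) \<times> (real^'n)\<close>, whose norm and inner product
  are the Euclidean ones.
\<close>

text \<open>
  Gradients of functions given on a set \<open>S\<close> that need not have interior points: \<open>G\<close> represents the
  derivative within \<open>S\<close>. It is determined by \<open>g\<close> at interior points only, so statements about an
  arbitrary such \<open>G\<close> cover every choice of gradient elsewhere.
\<close>

definition gradient_on ::
  "('a::real_inner \<Rightarrow> real) \<Rightarrow> ('a \<Rightarrow> 'a) \<Rightarrow> 'a set \<Rightarrow> bool" where
  "gradient_on g G S \<longleftrightarrow> (\<forall>x\<in>S. (g has_derivative (\<lambda>u. u \<bullet> G x)) (at x within S))"

definition gradient :: "('a::real_inner \<Rightarrow> real) \<Rightarrow> 'a \<Rightarrow> 'a" where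
  "gradient l x = (THE D. GDERIV l x :> D)"

text \<open>
  The singular values of \<open>A\<close>: the square roots of the eigenvalues of \<open>A\<^sup>T A\<close>. (Only used for matrices
  of full column rank, for which all \<open>n\<close> of them are among the singular values.)
\<close>

definition singular_values :: "real^'n^'d \<Rightarrow> real set" where
  "singular_values A =
     {s. s \<ge> 0 \<and> (\<exists>x. x \<noteq> 0 \<and> (transpose A ** A) *v x = s\<^sup>2 *\<^sub>R x)}"

definition sigma_min :: "real^'n^'d \<Rightarrow> real" where
  "sigma_min A = (LEAST s. s \<in> singular_values A)"

definition sigma_max :: "real^'n^'d \<Rightarrow> real" where
  "sigma_max A = (GREATEST s. s \<in> singular_values A)"

text \<open>The action of the block matrix with rows \<open>(0, A)\<close> and \<open>(-A\<^sup>T, 0)\<close>.\<close>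

definition Q_op :: "real^'n^'d \<Rightarrow> (real^'d) \<times> (real^'n) \<Rightarrow> (real^'d) \<times> (real^'n)" where
  "Q_op A = (\<lambda>(w, v). (A *v v, - (transpose A *v w)))"

definition A_coeff :: "real \<Rightarrow> nat \<Rightarrow> real" where
  "A_coeff L k = (real k)\<^sup>2 / (4 * L)"

definition a_coeff :: "real \<Rightarrow> nat \<Rightarrow> real" where
  "a_coeff L k = A_coeff L k - A_coeff L (k - 1)"

text \<open>
  \<open>shifted s c\<close> is \<open>s\<^sup>2 + 4/c\<^sup>2\<close>; it gives \<open>L\<^sub>l\<close> at the largest and \<open>\<sigma>\<^sub>l\<close> at the least singular value.
\<close>

definition shifted :: "real \<Rightarrow> real \<Rightarrow> real" where
  "shifted s c = s\<^sup>2 + 4 / c\<^sup>2"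

definition pagd_threshold :: "real \<Rightarrow> real \<Rightarrow> real \<Rightarrow> real" where
  "pagd_threshold smin smax c =
     (let Ll = shifted smax c; sl = shifted smin c in
      ln (1 + 9 * sqrt 2 * Ll powr (3/2) * sl powr (-3/2) * (sl * c\<^sup>2 + 1)\<^sup>2)
        / ln (1 + sqrt (sl / (2 * Ll))))"

definition pagd_l ::
  "real^'n^'d \<Rightarrow> real \<Rightarrow> real^'d \<Rightarrow> real^'n \<Rightarrow> real^'n \<Rightarrow> real^'n \<Rightarrow> real" where
  "pagd_l A c w0 v0 v1 v =
     1/2 * ((v - v1) \<bullet> ((transpose A ** A + (4 / c\<^sup>2) *\<^sub>R mat 1) *v (v - v1)))
     + ((2 / c) *\<^sub>R v0 + transpose A *v w0) \<bullet> (v - v1)"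

definition B_coeff :: "real \<Rightarrow> real \<Rightarrow> nat \<Rightarrow> real" where
  "B_coeff Ll sl t =
     (if t = 0 then 0 else 1 / (2 * Ll) * (1 + sqrt (sl / (2 * Ll))) ^ (t - 1))"

definition b_coeff :: "real \<Rightarrow> real \<Rightarrow> nat \<Rightarrow> real" where
  "b_coeff Ll sl t = B_coeff Ll sl t - B_coeff Ll sl (t - 1)"

definition pagd_phi ::
  "(real^'n \<Rightarrow> real) \<Rightarrow> real \<Rightarrow> real \<Rightarrow> real^'n \<Rightarrow> (nat \<Rightarrow> real^'n) \<Rightarrow> nat \<Rightarrow> real^'n \<Rightarrow> real" where
  "pagd_phi l Ll sl start vh t u =
     (\<Sum>i = 1..t. b_coeff Ll sl i *
        (l (vh (i - 1)) + gradient l (vh (i - 1)) \<bullet> (u - vh (i - 1))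
         + sl / 2 * (norm (u - vh (i - 1)))\<^sup>2))
     + 1/2 * (norm (u - start))\<^sup>2"

text \<open>
  The sequences \<open>v\<close>, \<open>u\<close>, \<open>vh\<close> (for \<open>v\<^sub>t\<close>, \<open>u\<^sub>t\<close> and the extrapolated points) are the first \<open>T\<close>
  iterations from \<open>start\<close>. These are recursion equations, so such sequences always exist.
\<close>

definition pagd_run ::
  "(real^'n) set \<Rightarrow> (real^'n \<Rightarrow> real) \<Rightarrow> real \<Rightarrow> real \<Rightarrow> real^'n \<Rightarrow> nat \<Rightarrow>
   (nat \<Rightarrow> real^'n) \<Rightarrow> (nat \<Rightarrow> real^'n) \<Rightarrow> (nat \<Rightarrow> real^'n) \<Rightarrow> bool" where
  "pagd_run V l Ll sl start T v u vh \<longleftrightarrow>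
     v 0 = start \<and> u 0 = start \<and>
     (\<forall>t\<in>{1..T}.
        vh (t - 1) = (B_coeff Ll sl (t - 1) / B_coeff Ll sl t) *\<^sub>R v (t - 1)
                     + (b_coeff Ll sl t / B_coeff Ll sl t) *\<^sub>R u (t - 1) \<and>
        v t = arg_min (\<lambda>x. gradient l (vh (t - 1)) \<bullet> x + Ll * (norm (x - vh (t - 1)))\<^sup>2)
                      (\<lambda>x. x \<in> V) \<and>
        u t = arg_min (pagd_phi l Ll sl start vh t) (\<lambda>x. x \<in> V))"

text \<open>
  \<open>pagd_output A V L k G0 zp T z\<close>: \<open>z\<close> is returned by \<open>T\<close> iterations of the method for the
  subproblem with index \<open>k\<close>, where \<open>G0\<close> and \<open>zp\<close> stand for the gradient of \<open>g\<close> at the given point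
  and for \<open>z\<^sub>k\<^sub>-\<^sub>1\<close>. Ties in the final selection may be broken arbitrarily.
\<close>

definition pagd_output ::
  "real^'n^'d \<Rightarrow> (real^'n) set \<Rightarrow> real \<Rightarrow> nat \<Rightarrow> (real^'d) \<times> (real^'n) \<Rightarrow>
   (real^'d) \<times> (real^'n) \<Rightarrow> nat \<Rightarrow> (real^'d) \<times> (real^'n) \<Rightarrow> bool" where
  "pagd_output A V L k G0 zp T z \<longleftrightarrow>
     (let c = a_coeff L k;
          (w0, v0) = G0 + Q_op A zp;
          (w1, v1) = zp;
          Ll = shifted (sigma_max A) c;
          sl = shifted (sigma_min A) c;
          l = pagd_l A c w0 v0 v1
      in \<exists>v u vh t.
           pagd_run V l Ll sl v1 T v u vh \<and>
           is_arg_min (\<lambda>s. norm (v s - vh (s - 1))) (\<lambda>s. s \<in> {1..T}) t \<and>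
           z = (w1 - (c / 2) *\<^sub>R (w0 + A *v (v t - v1)), v t))"

end

theory Submission
  imports Defs
begin

text \<open>
  Eliminating the free block. The vector tested in the conclusion is
  \<open>(w\<^sup>0, v\<^sup>0) + (Q + (2/c) I)(z - z\<^sub>k\<^sub>-\<^sub>1)\<close> with \<open>c = a\<^sub>k\<close>. Its \<open>w\<close>-block is affine and the
  formula for the returned \<open>w\<close>-block is exactly its zero; after substituting it, the
  \<open>v\<close>-block becomes \<open>c/2\<close> times the gradient of the strongly convex quadratic \<open>l\<close>
  (\<open>operator_at_output\<close>). Hence it is enough that the returned \<open>v\<^sub>t\<close> satisfies
  \<open>c\<^sup>2 \<langle>\<nabla>l(v\<^sub>t), v\<^sub>t - y\<rangle> \<le> \<parallel>v\<^sub>t - v\<^sub>0\<parallel>\<^sup>2 + \<parallel>v\<^sub>t - y\<parallel>\<^sup>2\<close> for all \<open>y \<in> V\<close>: an approximate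
  solution of a constrained minimisation whose error is measured relative to the distance travelled
  from the starting point.

  Why the accelerated method delivers this. Let \<open>\<delta>\<close> be the smallest step
  \<open>\<parallel>v\<^sub>t - vhat\<^sub>t\<^sub>-\<^sub>1\<parallel>\<close>. Optimality of the proximal step makes \<open>\<langle>\<nabla>l(v\<^sub>t), v\<^sub>t - y\<rangle>\<close> at most
  \<open>3 L\<^sub>l \<delta> \<parallel>v\<^sub>t - y\<parallel>\<close> (\<open>gl_at_step\<close>), so the target follows from
  \<open>3 L\<^sub>l c\<^sup>2 \<delta> \<le> \<parallel>v\<^sub>t - v\<^sub>0\<parallel>\<close>. The proximal term is twice what descent needs, and the
  estimating-sequence argument keeps the surplus: the weighted sum of the squared steps is bounded by
  the squared distance \<open>\<parallel>x - v\<^sub>0\<parallel>\<^sup>2\<close> to the constrained minimiser \<open>x\<close> (\<open>estimate_sequence\<close>,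
  \<open>sum_steps_bound\<close>). The weights \<open>B\<^sub>t\<close> grow geometrically, and the lower bound on \<open>T\<close> is what
  makes \<open>\<delta>\<close> a small enough fraction of \<open>\<parallel>x - v\<^sub>0\<parallel>\<close> (\<open>best_step_bound\<close>). Finally strong
  convexity puts \<open>v\<^sub>t\<close> within \<open>3 (L\<^sub>l / \<sigma>\<^sub>l) \<delta>\<close> of \<open>x\<close>, which turns \<open>\<parallel>x - v\<^sub>0\<parallel>\<close> into
  \<open>\<parallel>v\<^sub>t - v\<^sub>0\<parallel>\<close>.

  The size of the threshold. The ratio \<open>L\<^sub>l / \<sigma>\<^sub>l\<close> is at most \<open>(\<sigma>\<^sub>m\<^sub>a\<^sub>x / \<sigma>\<^sub>m\<^sub>i\<^sub>n)\<^sup>2\<close> whatever \<open>c\<close> is,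
  so the denominator is at least a constant times \<open>\<sigma>\<^sub>m\<^sub>i\<^sub>n / \<sigma>\<^sub>m\<^sub>a\<^sub>x\<close>. The argument of the logarithm
  in the numerator is at most a product of powers of \<open>k\<close> and of \<open>max s (1/s)\<close>, where \<open>s\<close> runs
  through \<open>\<sigma>\<^sub>m\<^sub>i\<^sub>n\<close>, \<open>\<sigma>\<^sub>m\<^sub>a\<^sub>x\<close> and \<open>L\<close>, so its logarithm is at most a multiple of \<open>ln k\<close>, with
  a factor affine in the absolute logarithms of these parameters.
\<close>

section \<open>Extreme singular values and the Rayleigh quotient\<close>

text \<open>
  A zero of a positive semidefinite quadratic form minimises it, so the form cannot decrease to
  first order in any direction, in particular not along \<open>- f x\<close>.
\<close>

lemma psd_zero_imp_kernel:
  fixes f :: "'a::real_inner \<Rightarrow> 'a"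
  assumes "linear f" and sym: "\<And>x y. f x \<bullet> y = x \<bullet> f y"
    and psd: "\<And>x. 0 \<le> x \<bullet> f x" and x: "x \<bullet> f x = 0"
  shows "f x = 0"
proof (rule ccontr)
  assume "f x \<noteq> 0"
  define n where "n = f x \<bullet> f x"
  define K where "K = f x \<bullet> f (f x)"
  \<comment> \<open>Along \<open>x + t f x\<close> the form is \<open>2 n t + K t\<^sup>2\<close>; the \<open>+ 1\<close> only guards against \<open>K = 0\<close>.\<close>
  define t where "t = - n / (K + 1)"
  have n: "n > 0" using \<open>f x \<noteq> 0\<close> by (simp add: n_def)
  have K: "K \<ge> 0" using psd by (simp add: K_def)
  have "0 \<le> (x + t *\<^sub>R f x) \<bullet> f (x + t *\<^sub>R f x)" by (rule psd)
  also have "\<dots> = t * (2 * n + t * K)"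
    using sym[of x "f x"]
    by (simp add: linear_add[OF \<open>linear f\<close>] linear_scale[OF \<open>linear f\<close>] inner_add_left
        inner_add_right x n_def K_def algebra_simps)
  finally have "0 \<le> t * (2 * n + t * K)" .
  moreover have "t < 0" using n K by (simp add: t_def divide_neg_pos)
  moreover have "2 * n + t * K > 0"
  proof -
    have "n * K / (K + 1) \<le> n" using n K by (simp add: field_simps)
    then show ?thesis using n by (simp add: t_def)
  qed
  ultimately show False by (simp add: mult_neg_pos not_less[symmetric])
qed

text \<open>
  The Rayleigh quotient attains its minimum \<open>r\<close> on the compact unit sphere. Then \<open>f - r I\<close> is
  positive semidefinite with a zero at the minimiser, which is therefore an eigenvector.
\<close>

lemma rayleigh_min:
  fixes f :: "'a::euclidean_space \<Rightarrow> 'a"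
  assumes f: "linear f" and sym: "\<And>x y. f x \<bullet> y = x \<bullet> f y"
  obtains x r where "x \<noteq> 0" "f x = r *\<^sub>R x" "\<And>y. r * (norm y)\<^sup>2 \<le> y \<bullet> f y"
proof -
  have "continuous_on (sphere 0 1) (\<lambda>x. x \<bullet> f x)"
    by (intro continuous_intros linear_continuous_on linear_conv_bounded_linear[THEN iffD1] f)
  then obtain x where x: "norm x = 1" and xmin: "\<And>y. norm y = 1 \<Longrightarrow> x \<bullet> f x \<le> y \<bullet> f y"
    using continuous_attains_inf[of "sphere (0::'a) 1" "\<lambda>x. x \<bullet> f x"] by auto
  define r where "r = x \<bullet> f x"
  have lower: "r * (norm y)\<^sup>2 \<le> y \<bullet> f y" for y
  proof (cases "y = 0")
    case False
    then have "r \<le> ((1 / norm y) *\<^sub>R y) \<bullet> f ((1 / norm y) *\<^sub>R y)"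
      unfolding r_def by (intro xmin) simp
    also have "\<dots> = (y \<bullet> f y) / (norm y)\<^sup>2"
      by (simp add: linear_scale[OF f] power2_eq_square)
    finally show ?thesis using False by (simp add: field_simps)
  qed (simp add: linear_0[OF f])
  define F where "F y = f y - r *\<^sub>R y" for y
  have "F x = 0"
  proof (rule psd_zero_imp_kernel[of F x])
    show "linear F" unfolding F_def
      by (intro linear_compose_sub f linear_scaleR)
    show "F x \<bullet> y = x \<bullet> F y" for x y by (simp add: F_def inner_diff sym)
    show "0 \<le> y \<bullet> F y" for y
      using lower[of y] by (simp add: F_def inner_diff_right power2_norm_eq_inner)
    show "x \<bullet> F x = 0" using x by (simp add: F_def inner_diff_right r_def norm_eq_1)
  qed
  then have "f x = r *\<^sub>R x" by (simp add: F_def)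
  moreover have "x \<noteq> 0" using x by auto
  ultimately show ?thesis using that lower by blast
qed

lemma rayleigh_max:
  fixes f :: "'a::euclidean_space \<Rightarrow> 'a"
  assumes f: "linear f" and sym: "\<And>x y. f x \<bullet> y = x \<bullet> f y"
  obtains x r where "x \<noteq> 0" "f x = r *\<^sub>R x" "\<And>y. y \<bullet> f y \<le> r * (norm y)\<^sup>2"
proof -
  obtain x s where "x \<noteq> 0" "- f x = s *\<^sub>R x" "\<And>y. s * (norm y)\<^sup>2 \<le> y \<bullet> - f y"
    using rayleigh_min[of "\<lambda>x. - f x"] linear_compose_neg[OF f] sym by auto
  then have "x \<noteq> 0" "f x = (- s) *\<^sub>R x" "\<And>y. y \<bullet> f y \<le> - s * (norm y)\<^sup>2"
    by (auto simp: minus_equation_iff[of "f x"] le_minus_iff)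
  then show ?thesis by (rule that)
qed

lemma inner_gram:
  fixes A :: "real^'n^'d"
  shows "x \<bullet> ((transpose A ** A) *v y) = (A *v x) \<bullet> (A *v y)"
  by (metis dot_lmul_matrix matrix_vector_mul_assoc transpose_transpose vector_transpose_matrix inner_commute)

lemma singular_value_ratio:
  fixes A :: "real^'n^'d"
  assumes "(transpose A ** A) *v x = r *\<^sub>R x"
  shows "(norm (A *v x))\<^sup>2 = r * (norm x)\<^sup>2"
  using inner_gram[of x A x] assms by (simp add: power2_norm_eq_inner)

lemma singular_valueI:
  fixes A :: "real^'n^'d"
  assumes "(transpose A ** A) *v x = r *\<^sub>R x" "x \<noteq> 0"
  shows "0 \<le> r" "sqrt r \<in> singular_values A"
proof -
  show "0 \<le> r" using singular_value_ratio[OF assms(1)] assms(2)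
    by (metis zero_le_mult_iff zero_le_power2 norm_eq_zero zero_less_power2 less_le_not_le)
  then show "sqrt r \<in> singular_values A" using assms by (auto simp: singular_values_def)
qed

text \<open>
  The least singular value is the root of the minimal Rayleigh quotient of \<open>A\<^sup>T A\<close>: the latter is an
  eigenvalue, and every eigenvalue is a value of the quotient. In particular the least element that
  defines it exists.
\<close>

lemma sigma_min_bound:
  fixes A :: "real^'n^'d"
  shows "0 \<le> sigma_min A" "(sigma_min A)\<^sup>2 * (norm x)\<^sup>2 \<le> (norm (A *v x))\<^sup>2"
proof -
  obtain y r where y: "y \<noteq> 0" "(transpose A ** A) *v y = r *\<^sub>R y"
    and r: "\<And>z. r * (norm z)\<^sup>2 \<le> z \<bullet> ((transpose A ** A) *v z)"
    using rayleigh_min[of "\<lambda>x. (transpose A ** A) *v x"] inner_gram[of _ A] inner_commute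
    by (metis matrix_vector_mul_linear)
  have "sigma_min A = sqrt r" unfolding sigma_min_def
  proof (rule Least_equality)
    show "sqrt r \<in> singular_values A" using singular_valueI y by blast
    fix s assume "s \<in> singular_values A"
    then obtain z where z: "s \<ge> 0" "z \<noteq> 0" "(transpose A ** A) *v z = s\<^sup>2 *\<^sub>R z"
      by (auto simp: singular_values_def)
    then have "r * (norm z)\<^sup>2 \<le> s\<^sup>2 * (norm z)\<^sup>2"
      using r[of z] by (simp add: power2_norm_eq_inner)
    then show "sqrt r \<le> s" using z by (simp add: real_le_lsqrt)
  qed
  moreover have "0 \<le> r" using singular_valueI y by blast
  ultimately show "0 \<le> sigma_min A" "(sigma_min A)\<^sup>2 * (norm x)\<^sup>2 \<le> (norm (A *v x))\<^sup>2"
    using r[of x] by (simp_all add: inner_gram power2_norm_eq_inner)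
qed

lemma sigma_max_bound:
  fixes A :: "real^'n^'d"
  shows "0 \<le> sigma_max A" "norm (A *v x) \<le> sigma_max A * norm x"
proof -
  obtain y r where y: "y \<noteq> 0" "(transpose A ** A) *v y = r *\<^sub>R y"
    and r: "\<And>z. z \<bullet> ((transpose A ** A) *v z) \<le> r * (norm z)\<^sup>2"
    using rayleigh_max[of "\<lambda>x. (transpose A ** A) *v x"] inner_gram[of _ A] inner_commute
    by (metis matrix_vector_mul_linear)
  have eq: "sigma_max A = sqrt r" unfolding sigma_max_def
  proof (rule Greatest_equality)
    show "sqrt r \<in> singular_values A" using singular_valueI y by blast
    fix s assume "s \<in> singular_values A"
    then obtain z where z: "s \<ge> 0" "z \<noteq> 0" "(transpose A ** A) *v z = s\<^sup>2 *\<^sub>R z"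
      by (auto simp: singular_values_def)
    then have "s\<^sup>2 * (norm z)\<^sup>2 \<le> r * (norm z)\<^sup>2"
      using r[of z] by (simp add: power2_norm_eq_inner)
    then show "s \<le> sqrt r" using z by (simp add: real_le_rsqrt)
  qed
  have r0: "0 \<le> r" using singular_valueI y by blast
  show pos: "0 \<le> sigma_max A" using eq r0 by simp
  have "(norm (A *v x))\<^sup>2 \<le> (sigma_max A * norm x)\<^sup>2"
    using r[of x] r0 by (simp add: eq inner_gram power2_norm_eq_inner power_mult_distrib)
  then show "norm (A *v x) \<le> sigma_max A * norm x"
    using pos by (simp add: power2_le_iff_abs_le)
qed

text \<open>
  The norm bound on \<open>A\<close> transfers to \<open>A\<^sup>T A\<close> by duality, testing the vector \<open>A\<^sup>T A x\<close> against itself.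
\<close>

lemma norm_gram_le:
  fixes A :: "real^'n^'d"
  shows "norm ((transpose A ** A) *v x) \<le> (sigma_max A)\<^sup>2 * norm x"
proof -
  define y where "y = (transpose A ** A) *v x"
  have "norm y * norm y = (A *v y) \<bullet> (A *v x)"
    using inner_gram[of y A x] by (simp add: y_def flip: power2_norm_eq_inner power2_eq_square)
  also have "\<dots> \<le> norm (A *v y) * norm (A *v x)" by (rule norm_cauchy_schwarz)
  also have "\<dots> \<le> (sigma_max A * norm y) * (sigma_max A * norm x)"
    by (intro mult_mono sigma_max_bound mult_nonneg_nonneg) auto
  finally have "norm y * norm y \<le> norm y * ((sigma_max A)\<^sup>2 * norm x)"
    by (simp add: power2_eq_square algebra_simps)
  then show ?thesis unfolding y_def[symmetric]
    by (cases "y = 0") auto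
qed

section \<open>Minimising isotropic quadratics over a convex set\<close>

text \<open>
  Both minimisations of the method have an objective whose quadratic part is a multiple of the squared
  norm. Completing the square turns such a problem into a projection onto \<open>V\<close>, so that existence of
  the minimiser, its variational inequality and quadratic growth all come from the closest point.
\<close>

lemma arg_min_isotropic_quadratic:
  fixes F :: "'a::euclidean_space \<Rightarrow> real"
  assumes V: "closed V" "convex V" "V \<noteq> {}" and mu: "\<mu> > 0"
    and F: "\<And>x. F x = \<mu> / 2 * (norm x)\<^sup>2 + q \<bullet> x + C"
    and m: "m = arg_min F (\<lambda>x. x \<in> V)"
  shows "m \<in> V"
    and "y \<in> V \<Longrightarrow> 0 \<le> (\<mu> *\<^sub>R m + q) \<bullet> (y - m)"
    and "y \<in> V \<Longrightarrow> F m + \<mu> / 2 * (norm (y - m))\<^sup>2 \<le> F y"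
proof -
  define p where "p = - (1 / \<mu>) *\<^sub>R q"
  have q: "q = - \<mu> *\<^sub>R p" using mu by (simp add: p_def)
  have Fp: "F x = \<mu> / 2 * (dist p x)\<^sup>2 + (C - \<mu> / 2 * (norm p)\<^sup>2)" for x
    by (simp add: F q dist_norm power2_norm_eq_inner inner_diff inner_commute algebra_simps)
  have "is_arg_min F (\<lambda>x. x \<in> V) (closest_point V p)"
    using V mu by (simp add: is_arg_min_linorder Fp closest_point_in_set closest_point_le)
  then have "is_arg_min F (\<lambda>x. x \<in> V) m" unfolding m arg_min_def by (rule someI)
  then have mV: "m \<in> V" and "\<And>y. y \<in> V \<Longrightarrow> F m \<le> F y" by (auto simp: is_arg_min_linorder)
  then have "\<forall>y\<in>V. dist p m \<le> dist p y" using mu by (simp add: Fp)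
  then have *: "(p - m) \<bullet> (y - m) \<le> 0" if "y \<in> V" for y
    using any_closest_point_dot V mV that by blast
  show "m \<in> V" by (rule mV)
  have eq: "\<mu> *\<^sub>R m + q = - \<mu> *\<^sub>R (p - m)" using mu by (simp add: p_def algebra_simps)
  show opt: "0 \<le> (\<mu> *\<^sub>R m + q) \<bullet> (y - m)" if "y \<in> V" for y
    unfolding eq using *[OF that] mu by (simp add: mult_nonneg_nonpos)
  show "F m + \<mu> / 2 * (norm (y - m))\<^sup>2 \<le> F y" if "y \<in> V" for y
  proof -
    have "F y = F m + (\<mu> *\<^sub>R m + q) \<bullet> (y - m) + \<mu> / 2 * (norm (y - m))\<^sup>2"
      unfolding F power2_norm_eq_inner inner_diff_left inner_diff_right inner_add_left inner_scaleR_left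
        inner_commute[of y m]
      by (simp add: field_simps)
    then show ?thesis using opt[OF that] by simp
  qed
qed

section \<open>Growth of the weights\<close>

lemma step_factor_pos: "0 < sl \<Longrightarrow> 0 < Ll \<Longrightarrow> 0 < sqrt (sl / (2 * Ll))"
  by simp

lemma B_coeff_pos:
  assumes "0 < sl" "0 < Ll" "1 \<le> t"
  shows "0 < B_coeff Ll sl t"
  using assms step_factor_pos[OF assms(1,2)] by (simp add: B_coeff_def add_pos_pos)

lemma B_coeff_nonneg:
  assumes "0 < sl" "0 < Ll"
  shows "0 \<le> B_coeff Ll sl t"
  using B_coeff_pos[OF assms, of t] by (cases "t = 0") (auto simp: B_coeff_def)

lemma B_coeff_Suc:
  "1 \<le> t \<Longrightarrow> B_coeff Ll sl (Suc t) = (1 + sqrt (sl / (2 * Ll))) * B_coeff Ll sl t"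
  by (cases t) (auto simp: B_coeff_def)

lemma B_coeff_Suc_eq: "B_coeff Ll sl (Suc t) = B_coeff Ll sl t + b_coeff Ll sl (Suc t)"
  by (simp add: b_coeff_def)

lemma b_coeff_pos:
  assumes "0 < sl" "0 < Ll"
  shows "0 < b_coeff Ll sl (Suc t)"
proof (cases t)
  case 0
  then show ?thesis using assms by (simp add: b_coeff_def B_coeff_def)
next
  case (Suc n)
  then have "b_coeff Ll sl (Suc t) = sqrt (sl / (2 * Ll)) * B_coeff Ll sl t"
    using B_coeff_Suc[of t Ll sl] by (simp add: b_coeff_def algebra_simps)
  then show ?thesis using step_factor_pos[OF assms] B_coeff_pos[OF assms, of t] Suc by simp
qed

text \<open>
  This limits how fast the weights may grow if the growth of the estimating function around its
  minimiser is to pay for the proximal term \<open>Ll * (norm (y - vh))\<^sup>2\<close> in \<open>estimate_sequence\<close>.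
  At \<open>t = 0\<close> it is an equality, which is why \<open>B 1 = 1 / (2 * Ll)\<close>.
\<close>

lemma step_condition:
  assumes "0 < sl" "0 < Ll"
  shows "2 * Ll * (b_coeff Ll sl (Suc t))\<^sup>2 \<le> (1 + sl * B_coeff Ll sl t) * B_coeff Ll sl (Suc t)"
proof (cases t)
  case 0
  then show ?thesis using assms by (simp add: b_coeff_def B_coeff_def power2_eq_square)
next
  case (Suc n)
  define q where "q = sqrt (sl / (2 * Ll))"
  define B where "B = B_coeff Ll sl t"
  have q: "0 < q" "2 * Ll * q\<^sup>2 = sl" using assms by (auto simp: q_def)
  have B: "0 < B" using B_coeff_pos[OF assms] Suc by (simp add: B_def)
  have BS: "B_coeff Ll sl (Suc t) = (1 + q) * B" using B_coeff_Suc[of t Ll sl] Suc by (simp add: q_def B_def)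
  have "b_coeff Ll sl (Suc t) = q * B"
    using BS by (simp add: b_coeff_def B_def[symmetric] algebra_simps)
  then have "2 * Ll * (b_coeff Ll sl (Suc t))\<^sup>2 = (sl * B) * B"
    by (simp add: q(2)[symmetric] power2_eq_square)
  also have "\<dots> \<le> (1 + sl * B) * ((1 + q) * B)"
    using q B assms by (intro mult_mono) (auto simp: algebra_simps)
  finally show ?thesis by (simp add: BS B_def)
qed

lemma sum_B_coeff:
  assumes "0 < sl" "0 < Ll"
  shows "(\<Sum>i = 1..T. B_coeff Ll sl i)
    = ((1 + sqrt (sl / (2 * Ll))) ^ T - 1) / (2 * Ll * sqrt (sl / (2 * Ll)))"
proof (induction T)
  case (Suc T)
  show ?case
    using assms step_factor_pos[OF assms]
    unfolding sum.cl_ivl_Suc Suc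
    by (simp add: B_coeff_def divide_simps del: real_sqrt_gt_0_iff) (simp add: algebra_simps)
qed simp

lemma powr_three_halves_quotient:
  fixes a b :: real
  assumes "0 < b" "0 < a"
  shows "a powr (3/2) * b powr (-3/2) = (a / b) * sqrt (a / b)"
proof -
  have "a powr (3/2) * b powr (-3/2) = (a / b) powr (3/2)"
    using assms powr_minus_divide[of b "3/2"] by (simp add: powr_divide)
  also have "\<dots> = (a / b) powr (1 + 1/2)" by simp
  also have "\<dots> = (a / b) powr 1 * (a / b) powr (1/2)" by (rule powr_add)
  also have "\<dots> = (a / b) * sqrt (a / b)"
    using assms by (simp add: powr_half_sqrt)
  finally show ?thesis .
qed

section \<open>Accelerated descent for strongly convex functions\<close>

text \<open>
  The analysis uses only first-order information about the objective: a gradient map \<open>gl\<close>, the lower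
  and upper quadratic models with moduli \<open>sl\<close> and \<open>Ll\<close>, and the Lipschitz bound for \<open>gl\<close>.
\<close>

locale accelerated_descent =
  fixes V :: "(real^'n) set" and l :: "real^'n \<Rightarrow> real" and gl :: "real^'n \<Rightarrow> real^'n"
    and Ll sl :: real and start :: "real^'n" and T :: nat and v u vh :: "nat \<Rightarrow> real^'n"
  assumes closed: "closed V" and convex: "convex V" and start: "start \<in> V"
    and sl: "0 < sl" and Ll: "0 < Ll"
    and gderiv: "\<And>x. GDERIV l x :> gl x"
    and strongly_convex: "\<And>x y. l x + gl x \<bullet> (y - x) + sl / 2 * (norm (y - x))\<^sup>2 \<le> l y"
    and smooth: "\<And>x y. l y \<le> l x + gl x \<bullet> (y - x) + Ll / 2 * (norm (y - x))\<^sup>2"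
    and gl_lipschitz: "\<And>x y. norm (gl x - gl y) \<le> Ll * norm (x - y)"
    and run: "pagd_run V l Ll sl start T v u vh"
begin

abbreviation "B \<equiv> B_coeff Ll sl"
abbreviation "b \<equiv> b_coeff Ll sl"
abbreviation "\<phi> \<equiv> pagd_phi l Ll sl start vh"

lemmas V = closed convex

lemma V_nonempty: "V \<noteq> {}"
  using start by blast

lemma gradient_eq: "gradient l x = gl x"
  unfolding gradient_def
proof (rule the_equality[where a = "gl x"])
  show "GDERIV l x :> gl x" by (rule gderiv)
  fix D assume "GDERIV l x :> D"
  then have "(\<lambda>h. h \<bullet> D) = (\<lambda>h. h \<bullet> gl x)"
    using gderiv[of x] unfolding gderiv_def by (rule has_derivative_unique)
  then show "D = gl x" by (metis inner_commute vector_eq_ldot)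
qed

lemma v_0: "v 0 = start" and u_0: "u 0 = start"
  using run by (auto simp: pagd_run_def)

lemma vh_eq: "Suc s \<le> T \<Longrightarrow> vh s = (B s / B (Suc s)) *\<^sub>R v s + (b (Suc s) / B (Suc s)) *\<^sub>R u s"
  and v_eq: "Suc s \<le> T \<Longrightarrow>
    v (Suc s) = arg_min (\<lambda>x. gl (vh s) \<bullet> x + Ll * (norm (x - vh s))\<^sup>2) (\<lambda>x. x \<in> V)"
  and u_eq: "1 \<le> t \<Longrightarrow> t \<le> T \<Longrightarrow> u t = arg_min (\<phi> t) (\<lambda>x. x \<in> V)"
  using run by (force simp: pagd_run_def gradient_eq)+

definition lin where "lin s x = l (vh s) + gl (vh s) \<bullet> (x - vh s)"

lemma phi_Suc: "\<phi> (Suc t) x = \<phi> t x + b (Suc t) * (lin t x + sl / 2 * (norm (x - vh t))\<^sup>2)"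
  by (simp add: pagd_phi_def lin_def gradient_eq)

lemma phi_0: "\<phi> 0 x = 1 / 2 * (norm (x - start))\<^sup>2"
  by (simp add: pagd_phi_def)

text \<open>
  The curvature of \<open>\<phi> t\<close> is \<open>1\<close> from the initial distance term plus \<open>sl * b i\<close> from the lower
  model of each iteration \<open>i \<le> t\<close>, and the \<open>b i\<close> telescope to \<open>B t\<close>.
\<close>

lemma phi_isotropic: "\<exists>q C. \<forall>x. \<phi> t x = (1 + sl * B t) / 2 * (norm x)\<^sup>2 + q \<bullet> x + C"
proof (induction t)
  case 0
  have "\<forall>x. \<phi> 0 x = (1 + sl * B 0) / 2 * (norm x)\<^sup>2 + (- start) \<bullet> x + (norm start)\<^sup>2 / 2"
    by (simp add: phi_0 B_coeff_def power2_norm_eq_inner inner_diff inner_commute field_simps)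
  then show ?case by blast
next
  case (Suc t)
  then obtain q C where qC: "\<And>x. \<phi> t x = (1 + sl * B t) / 2 * (norm x)\<^sup>2 + q \<bullet> x + C" by blast
  have "\<forall>x. \<phi> (Suc t) x = (1 + sl * B (Suc t)) / 2 * (norm x)\<^sup>2
      + (q + b (Suc t) *\<^sub>R (gl (vh t) - sl *\<^sub>R vh t)) \<bullet> x
      + (C + b (Suc t) * (l (vh t) - gl (vh t) \<bullet> vh t + sl / 2 * (norm (vh t))\<^sup>2))"
    by (auto simp add: phi_Suc qC B_coeff_Suc_eq lin_def power2_norm_eq_inner inner_diff inner_add
        inner_commute field_simps)
  then show ?case by blast
qed

lemma u_growth:
  assumes "t \<le> T"
  shows "u t \<in> V" "y \<in> V \<Longrightarrow> \<phi> t (u t) + (1 + sl * B t) / 2 * (norm (y - u t))\<^sup>2 \<le> \<phi> t y"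
proof -
  obtain q C where qC: "\<And>x. \<phi> t x = (1 + sl * B t) / 2 * (norm x)\<^sup>2 + q \<bullet> x + C"
    using phi_isotropic by blast
  have pos: "0 < 1 + sl * B t"
    using sl B_coeff_nonneg[OF sl Ll, of t] by (simp add: add_pos_nonneg)
  have "u t \<in> V \<and> (y \<in> V \<longrightarrow> \<phi> t (u t) + (1 + sl * B t) / 2 * (norm (y - u t))\<^sup>2 \<le> \<phi> t y)"
  proof (cases "t = 0")
    case True
    then show ?thesis using start by (simp add: u_0 phi_0 B_coeff_def)
  next
    case False
    then show ?thesis
      using arg_min_isotropic_quadratic[OF V V_nonempty pos qC u_eq] assms by auto
  qed
  then show "u t \<in> V" "y \<in> V \<Longrightarrow> \<phi> t (u t) + (1 + sl * B t) / 2 * (norm (y - u t))\<^sup>2 \<le> \<phi> t y"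
    by auto
qed

lemma v_step:
  assumes "Suc s \<le> T"
  shows "v (Suc s) \<in> V"
    and "y \<in> V \<Longrightarrow> 0 \<le> (gl (vh s) + (2 * Ll) *\<^sub>R (v (Suc s) - vh s)) \<bullet> (y - v (Suc s))"
    and "y \<in> V \<Longrightarrow> lin s (v (Suc s)) + Ll * (norm (v (Suc s) - vh s))\<^sup>2
      \<le> lin s y + Ll * (norm (y - vh s))\<^sup>2"
proof -
  define F where "F x = gl (vh s) \<bullet> x + Ll * (norm (x - vh s))\<^sup>2" for x
  have F: "F x = (2 * Ll) / 2 * (norm x)\<^sup>2 + (gl (vh s) - (2 * Ll) *\<^sub>R vh s) \<bullet> x
      + Ll * (norm (vh s))\<^sup>2" for x
    by (simp add: F_def power2_norm_eq_inner inner_diff inner_commute algebra_simps)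
  have m: "v (Suc s) = arg_min F (\<lambda>x. x \<in> V)"
    using v_eq[OF assms] by (simp add: F_def[abs_def])
  have "0 < 2 * Ll" using Ll by simp
  note am = arg_min_isotropic_quadratic[OF V V_nonempty this F m]
  show "v (Suc s) \<in> V" by (rule am)
  show "0 \<le> (gl (vh s) + (2 * Ll) *\<^sub>R (v (Suc s) - vh s)) \<bullet> (y - v (Suc s))" if "y \<in> V"
    using am(2)[OF that] by (simp add: algebra_simps)
  show "lin s (v (Suc s)) + Ll * (norm (v (Suc s) - vh s))\<^sup>2 \<le> lin s y + Ll * (norm (y - vh s))\<^sup>2"
    if "y \<in> V"
  proof -
    have "0 \<le> Ll * (norm (y - v (Suc s)))\<^sup>2" using Ll by simp
    then show ?thesis
      using am(3)[OF that] unfolding F_def lin_def inner_diff_right by simp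
  qed
qed

lemma v_in_V: "t \<le> T \<Longrightarrow> v t \<in> V"
  using v_step(1) v_0 start by (cases t) auto

text \<open>
  The estimating-sequence invariant. In the step from \<open>t\<close> to \<open>t + 1\<close>, growth of \<open>\<phi> t\<close> around
  \<open>u t\<close> contributes a multiple of \<open>(norm (u (t + 1) - u t))\<^sup>2\<close>. The convex combination \<open>y\<close> of
  \<open>v t\<close> and \<open>u (t + 1)\<close> differs from the extrapolated point by a multiple of that same vector, so
  the contribution dominates the proximal term at \<open>y\<close>, and \<open>v (t + 1)\<close> does at least as well as
  \<open>y\<close>. Since the proximal modulus \<open>Ll\<close> exceeds the \<open>Ll / 2\<close> of the upper model, half of each
  proximal term is left over and accumulates in the sum.
\<close>

lemma estimate_sequence:
  "t \<le> T \<Longrightarrow>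
    B t * l (v t) + Ll / 2 * (\<Sum>i = 1..t. B i * (norm (v i - vh (i - 1)))\<^sup>2) \<le> \<phi> t (u t)"
proof (induction t)
  case 0
  then show ?case by (simp add: phi_0 u_0 B_coeff_def)
next
  case (Suc t)
  define S where "S = Ll / 2 * (\<Sum>i = 1..t. B i * (norm (v i - vh (i - 1)))\<^sup>2)"
  define \<delta> where "\<delta> = norm (v (Suc t) - vh t)"
  define y where "y = (B t / B (Suc t)) *\<^sub>R v t + (b (Suc t) / B (Suc t)) *\<^sub>R u (Suc t)"
  have le: "t \<le> T" and Sle: "Suc t \<le> T" using Suc.prems by auto
  have BS: "0 < B (Suc t)" using B_coeff_pos[OF sl Ll, of "Suc t"] by simp
  have bS: "0 < b (Suc t)" using b_coeff_pos[OF sl Ll] .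
  have Bt: "0 \<le> B t" using B_coeff_nonneg[OF sl Ll] .
  have sum1: "B t / B (Suc t) + b (Suc t) / B (Suc t) = 1"
    using BS B_coeff_Suc_eq[of Ll sl t] by (simp flip: add_divide_distrib)
  have yV: "y \<in> V" unfolding y_def
    using convexD[OF convex v_in_V[OF le] u_growth(1)[OF Sle] _ _ sum1] BS bS Bt by simp
  have yvh: "y - vh t = (b (Suc t) / B (Suc t)) *\<^sub>R (u (Suc t) - u t)"
    by (simp add: y_def vh_eq[OF Sle] algebra_simps)
  have lin_y: "B (Suc t) * lin t y = B t * lin t (v t) + b (Suc t) * lin t (u (Suc t))"
  proof -
    have "B (Suc t) * lin t y = B (Suc t) * (l (vh t) - gl (vh t) \<bullet> vh t)
        + gl (vh t) \<bullet> (B (Suc t) *\<^sub>R y)"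
      by (simp add: lin_def inner_diff_right algebra_simps)
    also have "B (Suc t) *\<^sub>R y = B t *\<^sub>R v t + b (Suc t) *\<^sub>R u (Suc t)"
      using BS by (simp add: y_def scaleR_add_right)
    finally show ?thesis
      by (simp add: lin_def inner_diff_right inner_add_right B_coeff_Suc_eq algebra_simps)
  qed
  have quad: "B (Suc t) * (Ll * (norm (y - vh t))\<^sup>2)
      \<le> (1 + sl * B t) / 2 * (norm (u (Suc t) - u t))\<^sup>2"
  proof -
    have "B (Suc t) * (Ll * (norm (y - vh t))\<^sup>2)
        = (2 * Ll * (b (Suc t))\<^sup>2) * ((norm (u (Suc t) - u t))\<^sup>2 / (2 * B (Suc t)))"
      using BS bS by (simp only: yvh norm_scaleR power_mult_distrib power2_abs power_divide) (simp add: power2_eq_square)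
    also have "\<dots> \<le> ((1 + sl * B t) * B (Suc t)) * ((norm (u (Suc t) - u t))\<^sup>2 / (2 * B (Suc t)))"
      using step_condition[OF sl Ll, of t] BS by (intro mult_right_mono) auto
    also have "\<dots> = (1 + sl * B t) / 2 * (norm (u (Suc t) - u t))\<^sup>2"
      using BS by simp
    finally show ?thesis .
  qed
  have "l (v (Suc t)) + Ll / 2 * \<delta>\<^sup>2 \<le> lin t (v (Suc t)) + Ll * \<delta>\<^sup>2"
    using smooth[of "v (Suc t)" "vh t"] by (simp add: lin_def \<delta>_def)
  also have "\<dots> \<le> lin t y + Ll * (norm (y - vh t))\<^sup>2"
    unfolding \<delta>_def by (rule v_step(3)[OF Sle yV])
  finally have "B (Suc t) * (l (v (Suc t)) + Ll / 2 * \<delta>\<^sup>2)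
      \<le> B (Suc t) * (lin t y + Ll * (norm (y - vh t))\<^sup>2)"
    using BS by simp
  then have "B (Suc t) * (l (v (Suc t)) + Ll / 2 * \<delta>\<^sup>2) + S
      \<le> B t * lin t (v t) + b (Suc t) * lin t (u (Suc t))
        + (1 + sl * B t) / 2 * (norm (u (Suc t) - u t))\<^sup>2 + S"
    using quad lin_y by (simp add: distrib_left)
  also have "B t * lin t (v t) \<le> B t * l (v t)"
  proof (rule mult_left_mono[OF _ Bt])
    have "0 \<le> sl / 2 * (norm (v t - vh t))\<^sup>2" using sl by simp
    then show "lin t (v t) \<le> l (v t)"
      using strongly_convex[of "vh t" "v t"] by (simp add: lin_def)
  qed
  also have "B t * l (v t) + b (Suc t) * lin t (u (Suc t))
        + (1 + sl * B t) / 2 * (norm (u (Suc t) - u t))\<^sup>2 + S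
      \<le> \<phi> t (u (Suc t)) + b (Suc t) * lin t (u (Suc t))"
    using Suc.IH[OF le] u_growth(2)[OF le u_growth(1)[OF Sle]] by (simp add: S_def)
  also have "\<dots> \<le> \<phi> (Suc t) (u (Suc t))"
    using bS sl by (simp add: phi_Suc)
  finally show ?case by (simp add: S_def \<delta>_def distrib_left mult_ac add_ac)
qed

text \<open>
  Strong convexity forces every point outside a ball around the start to have a larger value than the
  start itself, so minimising over a compact set suffices.
\<close>

lemma minimizer:
  obtains x where "x \<in> V" "\<And>y. y \<in> V \<Longrightarrow> l x \<le> l y" "\<And>y. y \<in> V \<Longrightarrow> 0 \<le> gl x \<bullet> (y - x)"
proof -
  \<comment> \<open>Beyond this radius the quadratic term of the lower model at \<open>start\<close> outweighs the linear one.\<close>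
  define R where "R = 2 * norm (gl start) / sl"
  have R: "0 \<le> R" using sl by (simp add: R_def)
  have "continuous_on UNIV l"
    using gderiv unfolding gderiv_def
    by (intro continuous_at_imp_continuous_on ballI) (meson has_derivative_continuous)
  then have "continuous_on (V \<inter> cball start R) l" by (rule continuous_on_subset) simp
  moreover have "compact (V \<inter> cball start R)" by (simp add: closed closed_Int_compact)
  moreover have "start \<in> V \<inter> cball start R" using start R by simp
  ultimately obtain x where x: "x \<in> V" and xR: "\<And>y. y \<in> V \<inter> cball start R \<Longrightarrow> l x \<le> l y"
    using continuous_attains_inf[of "V \<inter> cball start R" l] by blast
  have xmin: "l x \<le> l y" if "y \<in> V" for y
  proof (cases "y \<in> cball start R")
    case False
    define n where "n = norm (y - start)"
    have n: "R < n" using False by (simp add: n_def dist_norm norm_minus_commute)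
    have "- (norm (gl start) * n) \<le> gl start \<bullet> (y - start)"
      using Cauchy_Schwarz_ineq2[of "gl start" "y - start"] by (simp add: n_def)
    moreover have "norm (gl start) * n \<le> sl / 2 * n\<^sup>2"
    proof -
      have "norm (gl start) \<le> sl / 2 * n" using n sl by (simp add: R_def field_simps)
      then have "norm (gl start) * n \<le> (sl / 2 * n) * n"
        using n R by (intro mult_right_mono) auto
      then show ?thesis by (simp add: power2_eq_square)
    qed
    ultimately have "l start \<le> l y"
      using strongly_convex[of start y] by (simp add: n_def)
    moreover have "l x \<le> l start" using start R by (intro xR) simp
    ultimately show ?thesis by simp
  qed (use that xR in simp)
  have "0 \<le> gl x \<bullet> (y - x)" if "y \<in> V" for y
  proof (rule ccontr)
    define m where "m = - (gl x \<bullet> (y - x))"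
    define K where "K = Ll * (norm (y - x))\<^sup>2"
    \<comment> \<open>A step of length \<open>e\<close> towards \<open>y\<close> changes the upper model by \<open>- e m + e\<^sup>2 K / 2\<close>.\<close>
    define e where "e = m / (m + K)"
    assume "\<not> ?thesis"
    then have m: "0 < m" by (simp add: m_def)
    have K: "0 \<le> K" using Ll by (simp add: K_def)
    have e: "0 < e" "e \<le> 1" using m K by (auto simp: e_def)
    have "x + e *\<^sub>R (y - x) \<in> V"
      using convexD_alt[OF convex x that, of e] e by (simp add: algebra_simps)
    then have "l x \<le> l (x + e *\<^sub>R (y - x))" by (rule xmin)
    also have "\<dots> \<le> l x - e * m + e\<^sup>2 * K / 2"
      using smooth[of "x + e *\<^sub>R (y - x)" x] by (simp add: m_def K_def power_mult_distrib mult_ac)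
    finally have "e * m \<le> e * (e * K / 2)" by (simp add: power2_eq_square)
    then have "m \<le> e * K / 2" using e by simp
    moreover have "e * K \<le> m" using m K by (simp add: e_def field_simps)
    ultimately show False using m by simp
  qed
  then show ?thesis using that x xmin by blast
qed

text \<open>
  The step makes the model gradient \<open>gl (vh s) + 2 * Ll * (v - vh s)\<close> point inwards; replacing it by
  the true gradient at \<open>v\<close> costs \<open>Ll\<close> for the change of gradient and \<open>2 * Ll\<close> for the proximal
  term.
\<close>

lemma gl_at_step:
  assumes "Suc s \<le> T" "y \<in> V"
  shows "gl (v (Suc s)) \<bullet> (v (Suc s) - y) \<le> 3 * Ll * norm (v (Suc s) - vh s) * norm (v (Suc s) - y)"
proof -
  let ?d = "v (Suc s) - vh s" and ?e = "v (Suc s) - y"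
  have "gl (v (Suc s)) \<bullet> ?e \<le> (gl (v (Suc s)) - gl (vh s) - (2 * Ll) *\<^sub>R ?d) \<bullet> ?e"
    using v_step(2)[OF assms] by (simp add: inner_diff inner_add_left algebra_simps)
  also have "\<dots> \<le> norm (gl (v (Suc s)) - gl (vh s) - (2 * Ll) *\<^sub>R ?d) * norm ?e"
    by (rule norm_cauchy_schwarz)
  also have "\<dots> \<le> (3 * Ll * norm ?d) * norm ?e"
  proof (rule mult_right_mono)
    have "norm (gl (v (Suc s)) - gl (vh s) - (2 * Ll) *\<^sub>R ?d)
        \<le> norm (gl (v (Suc s)) - gl (vh s)) + norm ((2 * Ll) *\<^sub>R ?d)"
      by (rule norm_triangle_ineq4)
    also have "\<dots> \<le> 3 * Ll * norm ?d"
      using gl_lipschitz[of "v (Suc s)" "vh s"] Ll by simp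
    finally show "norm (gl (v (Suc s)) - gl (vh s) - (2 * Ll) *\<^sub>R ?d) \<le> 3 * Ll * norm ?d" .
  qed simp
  finally show ?thesis .
qed

text \<open>
  Evaluating \<open>\<phi> T\<close> at a constrained minimiser \<open>x\<close> bounds its minimum from above. The terms
  \<open>B T * l x\<close> and \<open>B T * l (v T)\<close> compare in the favourable direction and drop out, leaving the
  accumulated squared steps against the initial distance.
\<close>

lemma sum_steps_bound:
  assumes "x \<in> V" "\<And>y. y \<in> V \<Longrightarrow> l x \<le> l y"
  shows "Ll * (\<Sum>i = 1..T. B i * (norm (v i - vh (i - 1)))\<^sup>2) \<le> (norm (x - start))\<^sup>2"
proof -
  have phi_le: "\<phi> t x \<le> B t * l x + 1 / 2 * (norm (x - start))\<^sup>2" for t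
  proof (induction t)
    case (Suc t)
    have "b (Suc t) * (lin t x + sl / 2 * (norm (x - vh t))\<^sup>2) \<le> b (Suc t) * l x"
      using strongly_convex[of "vh t" x] b_coeff_pos[OF sl Ll, of t] by (simp add: lin_def)
    then show ?case using Suc by (simp add: phi_Suc B_coeff_Suc_eq algebra_simps)
  qed (simp add: phi_0 B_coeff_def)
  have "0 \<le> (1 + sl * B T) / 2 * (norm (x - u T))\<^sup>2"
    using B_coeff_nonneg[OF sl Ll, of T] sl by simp
  then have "\<phi> T (u T) \<le> \<phi> T x" using u_growth(2)[of T x] assms(1) by simp
  moreover have "B T * l x \<le> B T * l (v T)"
    using assms(2) v_in_V B_coeff_nonneg[OF sl Ll] by (simp add: mult_left_mono)
  ultimately show ?thesis
    using estimate_sequence[of T] phi_le[of T] by simp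
qed

text \<open>
  The best step is no longer than the weighted root mean square of all steps. The geometric sum of the
  weights carries a factor \<open>1 / sqrt (sl / (2 * Ll))\<close>, which supplies the half power of \<open>Ll / sl\<close>
  by which the exponents \<open>3/2\<close> in the hypothesis fall short of the squared ratio \<open>Ll / sl\<close>.
\<close>

lemma best_step_bound:
  assumes t: "is_arg_min (\<lambda>s. norm (v s - vh (s - 1))) (\<lambda>s. s \<in> {1..T}) t"
    and T: "9 * sqrt 2 * Ll powr (3/2) * sl powr (-3/2) * (sl * c\<^sup>2 + 1)\<^sup>2
      \<le> (1 + sqrt (sl / (2 * Ll))) ^ T - 1"
    and x: "x \<in> V" "\<And>y. y \<in> V \<Longrightarrow> l x \<le> l y"
  shows "3 * (Ll / sl) * (sl * c\<^sup>2 + 1) * norm (v t - vh (t - 1)) \<le> norm (x - start)"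
proof -
  define \<delta> where "\<delta> = norm (v t - vh (t - 1))"
  define q where "q = sqrt (sl / (2 * Ll))"
  define E where "E = (sl * c\<^sup>2 + 1)\<^sup>2"
  have q: "0 < q" using sl Ll by (simp add: q_def)
  have E: "0 \<le> E" by (simp add: E_def)
  have le: "\<delta> \<le> norm (v i - vh (i - 1))" if "i \<in> {1..T}" for i
    using t that by (simp add: is_arg_min_linorder \<delta>_def)
  have "(\<Sum>i = 1..T. B i) * \<delta>\<^sup>2 \<le> (\<Sum>i = 1..T. B i * (norm (v i - vh (i - 1)))\<^sup>2)"
    unfolding sum_distrib_right
    by (intro sum_mono mult_left_mono power_mono le B_coeff_nonneg sl Ll) (auto simp: \<delta>_def)
  then have "Ll * ((\<Sum>i = 1..T. B i) * \<delta>\<^sup>2)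
      \<le> Ll * (\<Sum>i = 1..T. B i * (norm (v i - vh (i - 1)))\<^sup>2)"
    using Ll by (simp only: mult_le_cancel_left_pos)
  also have "\<dots> \<le> (norm (x - start))\<^sup>2" by (rule sum_steps_bound[OF x])
  finally have "Ll * (\<Sum>i = 1..T. B i) * \<delta>\<^sup>2 \<le> (norm (x - start))\<^sup>2"
    by (simp only: mult.assoc)
  moreover have "(3 * (Ll / sl) * (sl * c\<^sup>2 + 1))\<^sup>2 \<le> Ll * (\<Sum>i = 1..T. B i)"
  proof -
    have pw: "Ll powr (3/2) * sl powr (-3/2) = (Ll / sl) * sqrt (Ll / sl)"
      by (rule powr_three_halves_quotient[OF sl Ll])
    have qinv: "sqrt (Ll / sl) = 1 / (sqrt 2 * q)"
      using sl Ll by (simp add: q_def real_sqrt_divide real_sqrt_mult)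
    have q2: "1 / (q * q) = 2 * (Ll / sl)" using sl Ll by (simp add: q_def)
    have "(3 * (Ll / sl) * (sl * c\<^sup>2 + 1))\<^sup>2 = 9 * (Ll / sl) * (Ll / sl) * E"
      by (simp add: E_def power_mult_distrib power2_eq_square)
    also have "\<dots> = 9 * (Ll / sl) * E * (1 / (q * q)) / 2"
      unfolding q2 by simp
    also have "\<dots> = (9 * sqrt 2 * ((Ll / sl) * sqrt (Ll / sl)) * E) / (2 * q)"
      using q by (simp add: qinv)
    also have "\<dots> \<le> ((1 + q) ^ T - 1) / (2 * q)"
    proof (rule divide_right_mono)
      show "9 * sqrt 2 * ((Ll / sl) * sqrt (Ll / sl)) * E \<le> (1 + q) ^ T - 1"
        using T unfolding pw[symmetric] E_def q_def by (simp only: mult.assoc)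
    qed (use q in simp)
    also have "\<dots> = Ll * (\<Sum>i = 1..T. B i)"
      unfolding sum_B_coeff[OF sl Ll] q_def using Ll by simp
    finally show ?thesis .
  qed
  ultimately have "(3 * (Ll / sl) * (sl * c\<^sup>2 + 1))\<^sup>2 * \<delta>\<^sup>2 \<le> (norm (x - start))\<^sup>2"
    by (meson mult_right_mono order_trans zero_le_power2)
  then show ?thesis
    unfolding \<delta>_def[symmetric] power_mult_distrib[symmetric]
    by (rule power2_le_imp_le) simp
qed

text \<open>
  By \<open>gl_at_step\<close> it suffices that \<open>3 * Ll * c\<^sup>2\<close> times the best step is at most
  \<open>norm (v t - start)\<close>. The factor \<open>sl * c\<^sup>2 + 1\<close> in \<open>best_step_bound\<close> splits accordingly: its
  first summand gives this bound, and the \<open>1\<close> absorbs the distance from \<open>v t\<close> to the minimiser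
  when \<open>norm (x - start)\<close> is replaced by \<open>norm (v t - start)\<close>.
\<close>

lemma output_variational_bound:
  assumes t: "is_arg_min (\<lambda>s. norm (v s - vh (s - 1))) (\<lambda>s. s \<in> {1..T}) t"
    and T: "9 * sqrt 2 * Ll powr (3/2) * sl powr (-3/2) * (sl * c\<^sup>2 + 1)\<^sup>2
      \<le> (1 + sqrt (sl / (2 * Ll))) ^ T - 1"
    and y: "y \<in> V"
  shows "v t \<in> V" "c\<^sup>2 * (gl (v t) \<bullet> (v t - y)) \<le> (norm (v t - start))\<^sup>2 + (norm (v t - y))\<^sup>2"
proof -
  obtain x where x: "x \<in> V" "\<And>y. y \<in> V \<Longrightarrow> l x \<le> l y"
    and opt: "\<And>y. y \<in> V \<Longrightarrow> 0 \<le> gl x \<bullet> (y - x)"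
    using minimizer by blast
  obtain s where s: "t = Suc s" "Suc s \<le> T"
    using t by (cases t) (auto simp: is_arg_min_def)
  define \<delta> where "\<delta> = norm (v t - vh (t - 1))"
  have \<delta>: "0 \<le> \<delta>" by (simp add: \<delta>_def)
  have gl_le: "gl (v t) \<bullet> (v t - y) \<le> 3 * Ll * \<delta> * norm (v t - y)" if "y \<in> V" for y
    using gl_at_step[OF s(2) that] by (simp add: s \<delta>_def)
  show vV: "v t \<in> V" using v_in_V s by simp
  have near: "norm (v t - x) \<le> 3 * (Ll / sl) * \<delta>"
  proof -
    define n where "n = norm (v t - x)"
    have "sl * n\<^sup>2 \<le> (gl (v t) - gl x) \<bullet> (v t - x)"
      using strongly_convex[of "v t" x] strongly_convex[of x "v t"]
      by (simp add: n_def norm_minus_commute inner_diff algebra_simps)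
    also have "\<dots> \<le> 3 * Ll * \<delta> * n"
      using opt[OF vV] gl_le[OF x(1)] by (simp add: n_def inner_diff_left)
    finally have "n * (sl * n) \<le> n * (3 * Ll * \<delta>)" by (simp add: power2_eq_square algebra_simps)
    moreover have "0 \<le> n" by (simp add: n_def)
    moreover have "0 \<le> 3 * Ll * \<delta>" using Ll \<delta> by simp
    ultimately have "sl * n \<le> 3 * Ll * \<delta>" by (cases "n = 0") auto
    then show ?thesis using sl by (simp add: n_def field_simps)
  qed
  have "3 * (Ll / sl) * (sl * c\<^sup>2 + 1) * \<delta> \<le> norm (x - start)"
    unfolding \<delta>_def by (rule best_step_bound[OF t T x])
  also have "\<dots> \<le> norm (v t - start) + norm (v t - x)"
    using norm_triangle_ineq4[of "v t - start" "v t - x"] by simp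
  finally have "3 * (Ll / sl) * (sl * c\<^sup>2) * \<delta> \<le> norm (v t - start)"
    using near by (simp add: algebra_simps)
  then have *: "3 * Ll * c\<^sup>2 * \<delta> \<le> norm (v t - start)" using sl by simp
  have "c\<^sup>2 * (gl (v t) \<bullet> (v t - y)) \<le> c\<^sup>2 * (3 * Ll * \<delta> * norm (v t - y))"
    using gl_le[OF y] by (simp add: mult_left_mono)
  also have "\<dots> = (3 * Ll * c\<^sup>2 * \<delta>) * norm (v t - y)" by simp
  also have "\<dots> \<le> norm (v t - start) * norm (v t - y)"
    using * by (simp add: mult_right_mono)
  also have "\<dots> \<le> (norm (v t - start))\<^sup>2 + (norm (v t - y))\<^sup>2"
  proof -
    have "0 \<le> norm (v t - start) * norm (v t - y)" by simp
    then show ?thesis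
      using sum_squares_bound[of "norm (v t - start)" "norm (v t - y)"] by linarith
  qed
  finally show "c\<^sup>2 * (gl (v t) \<bullet> (v t - y)) \<le> (norm (v t - start))\<^sup>2 + (norm (v t - y))\<^sup>2" .
qed

end

section \<open>The quadratic subproblem\<close>

lemma a_coeff_eq: "1 \<le> k \<Longrightarrow> a_coeff L k = (2 * real k - 1) / (4 * L)"
  by (simp add: a_coeff_def A_coeff_def of_nat_diff power2_eq_square diff_divide_distrib[symmetric]
      algebra_simps)

lemma shifted_pos: "0 < c \<Longrightarrow> 0 < shifted s c"
  by (simp add: shifted_def add_nonneg_pos)

lemma pagd_threshold_power:
  assumes c: "0 < c" and T: "pagd_threshold smin smax c \<le> real T"
  defines "Ll \<equiv> shifted smax c" and "sl \<equiv> shifted smin c"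
  shows "9 * sqrt 2 * Ll powr (3/2) * sl powr (-3/2) * (sl * c\<^sup>2 + 1)\<^sup>2
    \<le> (1 + sqrt (sl / (2 * Ll))) ^ T - 1"
proof -
  define r where "r = sqrt (sl / (2 * Ll))"
  define N where "N = 9 * sqrt 2 * Ll powr (3/2) * sl powr (-3/2) * (sl * c\<^sup>2 + 1)\<^sup>2"
  have r: "0 < r" using shifted_pos[OF c] by (simp add: r_def Ll_def sl_def)
  have N: "0 \<le> N" by (simp add: N_def)
  have "ln (1 + N) / ln (1 + r) \<le> real T"
    using T by (simp add: pagd_threshold_def Let_def N_def r_def Ll_def sl_def)
  then have "ln (1 + N) \<le> real T * ln (1 + r)" using r by (simp add: divide_le_eq)
  also have "\<dots> = ln ((1 + r) ^ T)" using r by (simp add: ln_realpow)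
  finally have "1 + N \<le> (1 + r) ^ T" using r N by (subst (asm) ln_le_cancel_iff) auto
  then show ?thesis by (simp add: N_def r_def)
qed

definition pagd_l_grad ::
  "real^'n^'d \<Rightarrow> real \<Rightarrow> real^'d \<Rightarrow> real^'n \<Rightarrow> real^'n \<Rightarrow> real^'n \<Rightarrow> real^'n" where
  "pagd_l_grad A c w0 v0 v1 x =
     (transpose A ** A) *v (x - v1) + (4 / c\<^sup>2) *\<^sub>R (x - v1) + ((2 / c) *\<^sub>R v0 + transpose A *v w0)"

lemma pagd_l_alt:
  fixes A :: "real^'n^'d"
  shows "pagd_l A c w0 v0 v1 x =
     1/2 * ((A *v (x - v1)) \<bullet> (A *v (x - v1)) + 4 / c\<^sup>2 * ((x - v1) \<bullet> (x - v1)))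
     + ((2 / c) *\<^sub>R v0 + transpose A *v w0) \<bullet> (x - v1)"
proof -
  have "((4 / c\<^sup>2) *\<^sub>R mat 1) *v y = (4 / c\<^sup>2) *\<^sub>R y" for y :: "real^'n"
    by (simp add: scaleR_matrix_vector_assoc[symmetric])
  then show ?thesis
    by (simp add: pagd_l_def matrix_vector_mult_add_rdistrib inner_add_right inner_gram)
qed

text \<open>
  The exact second-order expansion; bounding \<open>norm (A *v (y - x))\<close> by the extreme singular values
  turns it into the two quadratic models.
\<close>

lemma pagd_l_expansion:
  "pagd_l A c w0 v0 v1 y = pagd_l A c w0 v0 v1 x + pagd_l_grad A c w0 v0 v1 x \<bullet> (y - x)
     + 1/2 * ((norm (A *v (y - x)))\<^sup>2 + 4 / c\<^sup>2 * (norm (y - x))\<^sup>2)"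
proof -
  define a where "a = x - v1"
  define d where "d = y - x"
  define p where "p = (2 / c) *\<^sub>R v0 + transpose A *v w0"
  have y: "y - v1 = a + d" by (simp add: a_def d_def)
  have "((transpose A ** A) *v a) \<bullet> d = (A *v a) \<bullet> (A *v d)"
    using inner_gram[of d A a] by (simp add: inner_commute)
  then show ?thesis
    unfolding pagd_l_alt pagd_l_grad_def p_def[symmetric] y a_def[symmetric] d_def[symmetric]
    by (simp add: power2_norm_eq_inner matrix_vector_right_distrib inner_add_left inner_add_right
        inner_commute[of d a] inner_commute[of "A *v d" "A *v a"] algebra_simps add_divide_distrib)
qed

lemma GDERIV_pagd_l: "GDERIV (pagd_l A c w0 v0 v1) x :> pagd_l_grad A c w0 v0 v1 x"
proof -
  have I: "((\<lambda>x. x - v1) has_derivative (\<lambda>h. h)) (at x)"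
    by (auto intro!: derivative_eq_intros)
  then have A: "((\<lambda>x. A *v (x - v1)) has_derivative (\<lambda>h. A *v h)) (at x)"
    by (rule bounded_linear.has_derivative[OF matrix_vector_mul_bounded_linear])
  have M: "h \<bullet> ((transpose A ** A) *v (x - v1)) = (A *v (x - v1)) \<bullet> (A *v h)" for h
    by (simp add: inner_gram inner_commute)
  define e where "e = 4 / c\<^sup>2"
  define p where "p = (2 / c) *\<^sub>R v0 + transpose A *v w0"
  have "((\<lambda>x. 1/2 * ((A *v (x - v1)) \<bullet> (A *v (x - v1)) + e * ((x - v1) \<bullet> (x - v1))) + p \<bullet> (x - v1))
      has_derivative (\<lambda>h. 1/2 * ((A *v (x - v1)) \<bullet> (A *v h) + (A *v h) \<bullet> (A *v (x - v1))
        + e * ((x - v1) \<bullet> h + h \<bullet> (x - v1))) + p \<bullet> h)) (at x)"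
    by (intro has_derivative_add has_derivative_mult_right has_derivative_inner
        has_derivative_inner_right A I)
  moreover have "(\<lambda>h. 1/2 * ((A *v (x - v1)) \<bullet> (A *v h) + (A *v h) \<bullet> (A *v (x - v1))
        + e * ((x - v1) \<bullet> h + h \<bullet> (x - v1))) + p \<bullet> h)
      = (\<lambda>h. h \<bullet> ((transpose A ** A) *v (x - v1) + e *\<^sub>R (x - v1) + p))"
    by (simp add: fun_eq_iff inner_add_right M inner_commute)
  ultimately show ?thesis
    unfolding gderiv_def pagd_l_alt[abs_def] pagd_l_grad_def e_def[symmetric] p_def[symmetric]
    by simp
qed

lemma pagd_l_grad_lipschitz:
  "norm (pagd_l_grad A c w0 v0 v1 x - pagd_l_grad A c w0 v0 v1 y)
    \<le> shifted (sigma_max A) c * norm (x - y)"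
proof -
  have "pagd_l_grad A c w0 v0 v1 x - pagd_l_grad A c w0 v0 v1 y
      = (transpose A ** A) *v (x - y) + (4 / c\<^sup>2) *\<^sub>R (x - y)"
    by (simp add: pagd_l_grad_def matrix_vector_mult_diff_distrib algebra_simps)
  also have "norm \<dots> \<le> (sigma_max A)\<^sup>2 * norm (x - y) + 4 / c\<^sup>2 * norm (x - y)"
    by (intro norm_triangle_le add_mono norm_gram_le) simp
  finally show ?thesis by (simp add: shifted_def distrib_right)
qed

lemma pagd_run_accelerated_descent:
  fixes A :: "real^'n^'d"
  assumes V: "closed V" "convex V" "v1 \<in> V" and c: "0 < c"
    and run: "pagd_run V (pagd_l A c w0 v0 v1) (shifted (sigma_max A) c) (shifted (sigma_min A) c)
      v1 T v u vh"
  shows "accelerated_descent V (pagd_l A c w0 v0 v1) (pagd_l_grad A c w0 v0 v1)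
    (shifted (sigma_max A) c) (shifted (sigma_min A) c) v1 T v u vh"
proof
  fix x y :: "real^'n"
  have min: "(sigma_min A)\<^sup>2 * (norm (y - x))\<^sup>2 \<le> (norm (A *v (y - x)))\<^sup>2"
    by (rule sigma_min_bound)
  have max: "(norm (A *v (y - x)))\<^sup>2 \<le> (sigma_max A)\<^sup>2 * (norm (y - x))\<^sup>2"
    using power_mono[OF sigma_max_bound(2)[of A "y - x"], of 2] by (simp add: power_mult_distrib)
  show "pagd_l A c w0 v0 v1 x + pagd_l_grad A c w0 v0 v1 x \<bullet> (y - x)
      + shifted (sigma_min A) c / 2 * (norm (y - x))\<^sup>2 \<le> pagd_l A c w0 v0 v1 y"
    using min by (simp add: pagd_l_expansion[of A c w0 v0 v1 y x] shifted_def distrib_right)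
  show "pagd_l A c w0 v0 v1 y \<le> pagd_l A c w0 v0 v1 x + pagd_l_grad A c w0 v0 v1 x \<bullet> (y - x)
      + shifted (sigma_max A) c / 2 * (norm (y - x))\<^sup>2"
    using max by (simp add: pagd_l_expansion[of A c w0 v0 v1 y x] shifted_def distrib_right)
qed (use assms shifted_pos GDERIV_pagd_l pagd_l_grad_lipschitz in auto)

text \<open>
  The \<open>w\<close>-block of the output is the exact zero of the first component. Inserting it into the second
  one replaces \<open>Q + (2/c) I\<close> by its Schur complement, \<open>c/2\<close> times the Hessian
  \<open>A\<^sup>T A + (4 / c\<^sup>2) I\<close> of \<open>pagd_l\<close>.
\<close>

lemma operator_at_output:
  fixes A :: "real^'n^'d" and w0 w1 :: "real^'d" and v0 v1 vt :: "real^'n"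
  assumes c: "0 < c"
  defines "wt \<equiv> w1 - (c / 2) *\<^sub>R (w0 + A *v (vt - v1))"
  shows "(w0, v0) + (Q_op A ((wt, vt) - (w1, v1)) + (2 / c) *\<^sub>R ((wt, vt) - (w1, v1)))
    = (0, (c / 2) *\<^sub>R pagd_l_grad A c w0 v0 v1 vt)"
proof -
  have w: "wt - w1 = - (c / 2) *\<^sub>R (w0 + A *v (vt - v1))" by (simp add: wt_def)
  have "w0 + A *v (vt - v1) + (2 / c) *\<^sub>R (wt - w1) = 0"
    unfolding w using c by simp
  moreover have "v0 + ((2 / c) *\<^sub>R (vt - v1) - transpose A *v (wt - w1))
      = (c / 2) *\<^sub>R pagd_l_grad A c w0 v0 v1 vt"
  proof -
    have "transpose A *v (wt - w1)
        = - (c / 2) *\<^sub>R (transpose A *v w0 + (transpose A ** A) *v (vt - v1))"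
      unfolding w by (simp only: matrix_vector_mult_scaleR matrix_vector_right_distrib
          matrix_vector_mul_assoc)
    moreover have "2 * c / c\<^sup>2 = 2 / c"
      using c by (simp add: power2_eq_square)
    ultimately show ?thesis
      unfolding pagd_l_grad_def scaleR_add_right using c by (simp add: scaleR_add_right)
  qed
  ultimately show ?thesis
    by (simp add: Q_op_def add.assoc)
qed

text \<open>
  Since the first component of the tested vector vanishes, the inner product sees only the \<open>v\<close>-blocks,
  and so the bound in \<open>V\<close> is enough: the squared norms of the full differences are even larger.
\<close>

lemma pagd_output_correct:
  fixes A :: "real^'n^'d" and zp G0 zhat z :: "(real^'d) \<times> (real^'n)"
  assumes V: "closed V" "convex V" "snd zp \<in> V" and c: "0 < a_coeff L k"
    and T: "pagd_threshold (sigma_min A) (sigma_max A) (a_coeff L k) \<le> real T"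
    and out: "pagd_output A V L k G0 zp T zhat" and z: "snd z \<in> V"
  shows "snd zhat \<in> V"
    and "a_coeff L k *
        ((G0 + Q_op A zp + (Q_op A (zhat - zp) + (2 / a_coeff L k) *\<^sub>R (zhat - zp))) \<bullet> (zhat - z))
      - 1/2 * ((norm (zhat - zp))\<^sup>2 + (norm (zhat - z))\<^sup>2) \<le> 0"
proof -
  define c where "c = a_coeff L k"
  obtain w0 v0 where G0: "G0 + Q_op A zp = (w0, v0)" by fastforce
  obtain w1 v1 where zp: "zp = (w1, v1)" by fastforce
  obtain w y where z_eq: "z = (w, y)" by fastforce
  obtain v u vh t where
    run: "pagd_run V (pagd_l A c w0 v0 v1) (shifted (sigma_max A) c) (shifted (sigma_min A) c)
      v1 T v u vh"
    and t: "is_arg_min (\<lambda>s. norm (v s - vh (s - 1))) (\<lambda>s. s \<in> {1..T}) t"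
    and zhat: "zhat = (w1 - (c / 2) *\<^sub>R (w0 + A *v (v t - v1)), v t)"
    using out by (auto simp: pagd_output_def Let_def G0[unfolded zp] zp c_def[symmetric] simp del: One_nat_def)
  have c0: "0 < c" using c by (simp add: c_def)
  interpret accelerated_descent V "pagd_l A c w0 v0 v1" "pagd_l_grad A c w0 v0 v1"
    "shifted (sigma_max A) c" "shifted (sigma_min A) c" v1 T v u vh
    using V zp c0 run by (intro pagd_run_accelerated_descent) auto
  have bound: "v t \<in> V" "c\<^sup>2 * (pagd_l_grad A c w0 v0 v1 (v t) \<bullet> (v t - y))
      \<le> (norm (v t - v1))\<^sup>2 + (norm (v t - y))\<^sup>2"
    using output_variational_bound[OF t pagd_threshold_power[OF c0]] T z
    by (auto simp: c_def z_eq)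
  show "snd zhat \<in> V" using bound(1) by (simp add: zhat)
  have "(G0 + Q_op A zp + (Q_op A (zhat - zp) + (2 / c) *\<^sub>R (zhat - zp)))
      = (0, (c / 2) *\<^sub>R pagd_l_grad A c w0 v0 v1 (v t))"
    unfolding G0 unfolding zp zhat by (rule operator_at_output[OF c0])
  then have "c * ((G0 + Q_op A zp + (Q_op A (zhat - zp) + (2 / c) *\<^sub>R (zhat - zp))) \<bullet> (zhat - z))
      = 1/2 * (c\<^sup>2 * (pagd_l_grad A c w0 v0 v1 (v t) \<bullet> (v t - y)))"
    by (simp add: zhat z_eq power2_eq_square)
  also have "\<dots> \<le> 1/2 * ((norm (v t - v1))\<^sup>2 + (norm (v t - y))\<^sup>2)"
    using bound(2) by simp
  also have "\<dots> \<le> 1/2 * ((norm (zhat - zp))\<^sup>2 + (norm (zhat - z))\<^sup>2)"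
  proof -
    have "norm (v t - v1) \<le> norm (zhat - zp)" "norm (v t - y) \<le> norm (zhat - z)"
      by (simp_all add: zhat zp z_eq norm_snd_le)
    then show ?thesis by (intro mult_left_mono add_mono power_mono) auto
  qed
  finally show "a_coeff L k *
        ((G0 + Q_op A zp + (Q_op A (zhat - zp) + (2 / a_coeff L k) *\<^sub>R (zhat - zp))) \<bullet> (zhat - z))
      - 1/2 * ((norm (zhat - zp))\<^sup>2 + (norm (zhat - z))\<^sup>2) \<le> 0"
    by (simp add: c_def)
qed

section \<open>The size of the threshold\<close>

text \<open>
  Adding the same amount to numerator and denominator moves a quotient that is at least \<open>1\<close> towards
  \<open>1\<close>. This makes the bounds on the threshold uniform in \<open>c\<close>.
\<close>

lemma shifted_ratio_le:
  assumes "0 < smin" "smin \<le> smax"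
  shows "shifted smax c / shifted smin c \<le> (smax / smin)\<^sup>2"
proof -
  have pos: "0 < shifted smin c" using assms by (simp add: shifted_def add_pos_nonneg)
  have "smin\<^sup>2 \<le> smax\<^sup>2" using assms by (simp add: power_mono)
  then have "smin\<^sup>2 * (4 / c\<^sup>2) \<le> smax\<^sup>2 * (4 / c\<^sup>2)" by (rule mult_right_mono) simp
  then have "shifted smax c * smin\<^sup>2 \<le> smax\<^sup>2 * shifted smin c"
    by (simp add: shifted_def algebra_simps)
  then show ?thesis using pos assms by (simp add: field_simps)
qed

lemma half_le_ln_1_plus:
  fixes x :: real
  assumes "0 \<le> x" "x \<le> 1"
  shows "x / 2 \<le> ln (1 + x)"
proof -
  have "x / 2 \<le> x / (1 + x)" using assms by (intro divide_left_mono) auto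
  also have "\<dots> = 1 - 1 / (1 + x)" using assms by (simp add: field_simps)
  also have "\<dots> \<le> - ln (1 / (1 + x))"
    using ln_le_minus_one[of "1 / (1 + x)"] assms by simp
  also have "\<dots> = ln (1 + x)" using assms by (simp add: ln_div)
  finally show ?thesis .
qed

lemma threshold_denominator_lower:
  assumes s: "0 < smin" "smin \<le> smax"
  shows "smin / (2 * sqrt 2 * smax) \<le> ln (1 + sqrt (shifted smin c / (2 * shifted smax c)))"
proof -
  define r where "r = sqrt (shifted smin c / (2 * shifted smax c))"
  have pos: "0 < shifted smin c" "0 < shifted smax c"
    using s by (simp_all add: shifted_def add_pos_nonneg)
  have mono: "shifted smin c \<le> shifted smax c"
    using s by (simp add: shifted_def power_mono)
  have "(smin / smax)\<^sup>2 \<le> shifted smin c / shifted smax c"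
    using shifted_ratio_le[OF s, of c] pos s by (simp add: field_simps)
  then have "sqrt ((smin / smax)\<^sup>2 / 2) \<le> r"
    unfolding r_def real_sqrt_le_iff using pos by (simp add: field_simps)
  then have lower: "smin / (sqrt 2 * smax) \<le> r"
    using s by (simp add: real_sqrt_divide mult.commute)
  have "r \<le> 1" using mono pos by (simp add: r_def divide_le_eq)
  moreover have "0 \<le> r" using pos by (simp add: r_def)
  ultimately have "r / 2 \<le> ln (1 + r)" by (intro half_le_ln_1_plus)
  then show ?thesis using lower unfolding r_def[symmetric] by simp
qed

text \<open>
  With \<open>a\<close>, \<open>b\<close>, \<open>m\<close> the absolute logarithms of \<open>smin\<close>, \<open>smax\<close>, \<open>M\<close>, each of these
  parameters and its reciprocal is at most the exponential of its absolute logarithm. Since \<open>c\<close> grows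
  linearly in \<open>j\<close>, the argument of the logarithm is at most
  \<open>2 ^ 5 * exp (7 * a + 3 * b + 4 * m) * j ^ 4\<close>. For \<open>j \<ge> 2\<close> the constant is absorbed into
  \<open>j ^ 5\<close>, and the summand without \<open>ln j\<close> is absorbed using \<open>1 \<le> 2 * ln j\<close>.
\<close>

lemma threshold_numerator_upper:
  assumes s: "0 < smin" "smin \<le> smax" and M: "0 < M" and j: "2 \<le> j"
  defines "c \<equiv> a_coeff M j"
  shows "ln (1 + 9 * sqrt 2 * shifted smax c powr (3/2) * shifted smin c powr (-3/2)
      * (shifted smin c * c\<^sup>2 + 1)\<^sup>2)
    \<le> (9 + 14 * \<bar>ln smin\<bar> + 6 * \<bar>ln smax\<bar> + 8 * \<bar>ln M\<bar>) * ln (real j)"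
proof -
  define a where "a = \<bar>ln smin\<bar>"
  define b where "b = \<bar>ln smax\<bar>"
  define m where "m = \<bar>ln M\<bar>"
  define J where "J = real j"
  define q where "q = shifted smax c / shifted smin c"
  have J: "2 \<le> J" using j by (simp add: J_def)
  have smax: "0 < smax" using s by simp
  have c: "c = (2 * J - 1) / (4 * M)" using j by (simp add: c_def a_coeff_eq J_def)
  have cpos: "0 < c" using J M by (simp add: c)
  have q: "0 < q" by (simp add: q_def shifted_pos[OF cpos])
  have le_exp: "x \<le> exp \<bar>ln x\<bar>" "1 / x \<le> exp \<bar>ln x\<bar>" if "0 < x" for x :: real
    using that exp_ln[OF that] abs_ge_self[of "ln x"] abs_ge_minus_self[of "ln x"]
    by (metis exp_le_cancel_iff, metis exp_le_cancel_iff exp_minus inverse_eq_divide)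
  have sr: "smax / smin \<le> exp (a + b)"
  proof -
    have "smax * (1 / smin) \<le> exp b * exp a"
      unfolding a_def b_def using s smax by (intro mult_mono le_exp) auto
    then show ?thesis by (simp add: exp_add mult.commute)
  qed
  have q_le: "q * sqrt q \<le> exp (3 * a + 3 * b)"
  proof -
    have "q \<le> (smax / smin)\<^sup>2" unfolding q_def by (rule shifted_ratio_le[OF s])
    also have "\<dots> \<le> (exp (a + b))\<^sup>2" using sr s by (intro power_mono) auto
    finally have 1: "q \<le> (exp (a + b))\<^sup>2" .
    then have "sqrt q \<le> exp (a + b)" by (intro real_le_lsqrt) auto
    then have "q * sqrt q \<le> (exp (a + b))\<^sup>2 * exp (a + b)"
      using 1 q by (intro mult_mono) auto
    also have "\<dots> = exp (3 * a + 3 * b)"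
      by (simp add: power2_eq_square flip: exp_add)
    finally show ?thesis .
  qed
  have sc: "shifted smin c * c\<^sup>2 + 1 \<le> 3/2 * (exp (2 * a + 2 * m) * J\<^sup>2)"
  proof -
    have "c \<le> J * (1 / M) / 2" using M by (simp add: c field_simps)
    then have "smin * c \<le> smin * (J * (1 / M) / 2)"
      using s by (intro mult_left_mono) auto
    also have "\<dots> = J / 2 * (smin * (1 / M))" by (simp add: mult.commute)
    also have "\<dots> \<le> J / 2 * (exp a * exp m)"
      unfolding a_def m_def using s M J by (intro mult_left_mono mult_mono le_exp) auto
    finally have "smin * c \<le> J / 2 * exp (a + m)" by (simp add: exp_add)
    then have "(smin * c)\<^sup>2 \<le> (J / 2 * exp (a + m))\<^sup>2"
      using s cpos by (intro power_mono) auto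
    also have "\<dots> = exp (2 * a + 2 * m) * J\<^sup>2 / 4"
      by (simp add: power_mult_distrib power_divide power2_eq_square[of "exp _"] flip: exp_add)
    finally have 1: "(smin * c)\<^sup>2 \<le> exp (2 * a + 2 * m) * J\<^sup>2 / 4" .
    have "1 * 2\<^sup>2 \<le> exp (2 * a + 2 * m) * J\<^sup>2"
      using J by (intro mult_mono power_mono) (auto simp: a_def m_def)
    moreover have "shifted smin c * c\<^sup>2 = (smin * c)\<^sup>2 + 4"
      using cpos by (simp add: shifted_def power_mult_distrib field_simps)
    ultimately show ?thesis using 1 by simp
  qed
  have N: "9 * sqrt 2 * shifted smax c powr (3/2) * shifted smin c powr (-3/2)
      * (shifted smin c * c\<^sup>2 + 1)\<^sup>2 \<le> 31 * (exp (7 * a + 3 * b + 4 * m) * J ^ 4)"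
  proof -
    have "9 * sqrt 2 * shifted smax c powr (3/2) * shifted smin c powr (-3/2)
        * (shifted smin c * c\<^sup>2 + 1)\<^sup>2
        = 9 * sqrt 2 * ((q * sqrt q) * (shifted smin c * c\<^sup>2 + 1)\<^sup>2)"
      unfolding q_def powr_three_halves_quotient[OF shifted_pos[OF cpos] shifted_pos[OF cpos], symmetric]
      by (simp only: mult.assoc)
    \<comment> \<open>Here \<open>sqrt 2\<close> is rounded up to \<open>3/2\<close>, and \<open>9 * (3/2) * (3/2)\<^sup>2 = 243/8\<close> to \<open>31\<close> below, leaving room for the
      summand \<open>1\<close> under \<open>2 ^ 5\<close>.\<close>
    also have "\<dots> \<le> (9 * (3/2)) * (exp (3 * a + 3 * b) * (3/2 * (exp (2 * a + 2 * m) * J\<^sup>2))\<^sup>2)"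
    proof (intro mult_mono q_le power_mono sc order.refl)
      show "sqrt 2 \<le> 3/2" by (rule real_le_lsqrt) (auto simp: power2_eq_square)
      show "0 \<le> shifted smin c * c\<^sup>2 + 1" using shifted_pos[OF cpos, of smin] by simp
      then show "0 \<le> (q * sqrt q) * (shifted smin c * c\<^sup>2 + 1)\<^sup>2" using q by simp
    qed auto
    also have "\<dots> = 243/8 * (exp (3 * a + 3 * b) * (exp (2 * a + 2 * m))\<^sup>2 * J ^ 4)"
      by (simp add: power_mult_distrib power2_eq_square power4_eq_xxxx)
    also have "exp (3 * a + 3 * b) * (exp (2 * a + 2 * m))\<^sup>2 = exp (7 * a + 3 * b + 4 * m)"
      by (simp add: power2_eq_square flip: exp_add)
    finally show ?thesis by (rule order_trans) (simp add: J_def)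
  qed
  have "1 \<le> exp (7 * a + 3 * b + 4 * m) * J ^ 4"
    using mult_mono[of 1 "exp (7 * a + 3 * b + 4 * m)" 1 "J ^ 4"] J
    by (simp add: a_def b_def m_def)
  with N have "1 + 9 * sqrt 2 * shifted smax c powr (3/2) * shifted smin c powr (-3/2)
      * (shifted smin c * c\<^sup>2 + 1)\<^sup>2 \<le> 2 ^ 5 * (exp (7 * a + 3 * b + 4 * m) * J ^ 4)"
    by simp
  also have "\<dots> \<le> J ^ 5 * (exp (7 * a + 3 * b + 4 * m) * J ^ 4)"
    using J by (intro mult_right_mono power_mono) auto
  also have "\<dots> = exp (7 * a + 3 * b + 4 * m) * J ^ 9"
    by (simp add: power_add[symmetric] flip: mult.assoc)
  finally have "ln (1 + 9 * sqrt 2 * shifted smax c powr (3/2) * shifted smin c powr (-3/2)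
      * (shifted smin c * c\<^sup>2 + 1)\<^sup>2) \<le> ln (exp (7 * a + 3 * b + 4 * m) * J ^ 9)"
    by (subst ln_le_cancel_iff) (use J in \<open>auto intro!: add_pos_nonneg mult_nonneg_nonneg\<close>)
  also have "\<dots> = (7 * a + 3 * b + 4 * m) * 1 + 9 * ln J"
    using J by (simp add: ln_mult ln_realpow)
  also have "\<dots> \<le> (7 * a + 3 * b + 4 * m) * (2 * ln J) + 9 * ln J"
  proof (intro add_right_mono mult_left_mono)
    have "1 / 2 \<le> ln (2::real)" using half_le_ln_1_plus[of 1] by simp
    also have "\<dots> \<le> ln J" using J by simp
    finally show "1 \<le> 2 * ln J" by simp
  qed (simp add: a_def b_def m_def)
  finally show ?thesis by (simp add: a_def b_def m_def J_def algebra_simps)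
qed

lemma pagd_threshold_upper:
  assumes s: "0 < smin" "smin \<le> smax" and M: "0 < M" and j: "2 \<le> j"
  shows "\<bar>pagd_threshold smin smax (a_coeff M j)\<bar>
    \<le> 42 * ((1 + \<bar>ln smin\<bar>) + (1 + \<bar>ln smax\<bar>) + (1 + \<bar>ln M\<bar>)) * (smax / smin * ln (real j))"
proof -
  define c where "c = a_coeff M j"
  define K where "K = 9 + 14 * \<bar>ln smin\<bar> + 6 * \<bar>ln smax\<bar> + 8 * \<bar>ln M\<bar>"
  define N where "N = ln (1 + 9 * sqrt 2 * shifted smax c powr (3/2) * shifted smin c powr (-3/2)
      * (shifted smin c * c\<^sup>2 + 1)\<^sup>2)"
  define D where "D = ln (1 + sqrt (shifted smin c / (2 * shifted smax c)))"
  have N0: "0 \<le> N" by (simp add: N_def)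
  have N: "N \<le> K * ln (real j)"
    unfolding N_def K_def c_def by (rule threshold_numerator_upper[OF s M j])
  have D: "smin / (2 * sqrt 2 * smax) \<le> D"
    unfolding D_def by (rule threshold_denominator_lower[OF s])
  have E: "0 < smin / (2 * sqrt 2 * smax)" using s by simp
  have lnj: "0 \<le> ln (real j)" using j by simp
  have s32: "sqrt 2 \<le> 3/2" by (rule real_le_lsqrt) (auto simp: power2_eq_square)
  have "\<bar>pagd_threshold smin smax c\<bar> = N / D"
    using N0 D E by (simp add: pagd_threshold_def Let_def N_def D_def)
  also have "\<dots> \<le> (K * ln (real j)) / (smin / (2 * sqrt 2 * smax))"
    using N N0 D E by (intro frac_le) auto
  also have "\<dots> = (2 * sqrt 2 * K) * (smax / smin * ln (real j))"
    using s by (simp add: field_simps)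
  also have "\<dots> \<le> 42 * ((1 + \<bar>ln smin\<bar>) + (1 + \<bar>ln smax\<bar>) + (1 + \<bar>ln M\<bar>)) * (smax / smin * ln (real j))"
  proof (rule mult_right_mono)
    have "2 * sqrt 2 * K \<le> 3 * K" using s32 by (intro mult_right_mono) (auto simp: K_def)
    also have "\<dots> \<le> 42 * ((1 + \<bar>ln smin\<bar>) + (1 + \<bar>ln smax\<bar>) + (1 + \<bar>ln M\<bar>))"
      by (simp add: K_def)
    finally show "2 * sqrt 2 * K \<le> 42 * ((1 + \<bar>ln smin\<bar>) + (1 + \<bar>ln smax\<bar>) + (1 + \<bar>ln M\<bar>))" .
  qed (use s lnj in simp)
  finally show ?thesis by (simp add: c_def)
qed

section \<open>Correctness and iteration count\<close>

theorem theorem2: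
  fixes A :: "real^'n^'d" and V :: "(real^'n) set"
    and f :: "real^'d \<Rightarrow> real" and h :: "real^'n \<Rightarrow> real"
    and g :: "(real^'d) \<times> (real^'n) \<Rightarrow> real"
    and G :: "(real^'d) \<times> (real^'n) \<Rightarrow> (real^'d) \<times> (real^'n)"
    and X :: "((real^'d) \<times> (real^'n)) set"
    and L :: real and k :: nat
    and xhat zprev :: "(real^'d) \<times> (real^'n)"
  assumes V: "V \<noteq> {}" "closed V" "convex V"
    and X: "X = UNIV \<times> V"
    and f: "convex_on UNIV f" "f differentiable_on UNIV"
    and h: "convex_on V h" "h differentiable_on V"
    and g: "\<And>w v. g (w, v) = f w + h v"
    and G: "gradient_on g G X"
    and g_convex: "\<And>x y. x \<in> X \<Longrightarrow> y \<in> X \<Longrightarrow> g x \<ge> g y + G y \<bullet> (x - y)"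
    and L: "L > 0"
    and G_lipschitz: "\<And>x y. x \<in> X \<Longrightarrow> y \<in> X \<Longrightarrow> norm (G x - G y) \<le> L * norm (x - y)"
    and A: "rank A = CARD('n)"
    and k: "k \<ge> 1"
    and pts: "xhat \<in> X" "zprev \<in> X"
  shows
    "(\<forall>(T::nat) zhat.
        real T \<ge> pagd_threshold (sigma_min A) (sigma_max A) (a_coeff L k) \<longrightarrow>
        pagd_output A V L k (G xhat) zprev T zhat \<longrightarrow>
        zhat \<in> X \<and>
        (\<forall>z\<in>X.
           a_coeff L k *
             ((G xhat + Q_op A zprev
               + (Q_op A (zhat - zprev) + (2 / a_coeff L k) *\<^sub>R (zhat - zprev))) \<bullet> (zhat - z))
           - 1/2 * ((norm (zhat - zprev))\<^sup>2 + (norm (zhat - z))\<^sup>2) \<le> 0))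
     \<and>
     (\<exists>(F :: real \<Rightarrow> real \<Rightarrow> real \<Rightarrow> real) (P :: real \<times> real \<times> real \<Rightarrow> real).
        real_polynomial_function P \<and>
        (\<forall>smin smax M :: real. 0 < smin \<and> smin \<le> smax \<and> 0 < M \<longrightarrow>
           F smin smax M \<le> P (1 + \<bar>ln smin\<bar>, 1 + \<bar>ln smax\<bar>, 1 + \<bar>ln M\<bar>) \<and>
           (\<forall>j::nat. 2 \<le> j \<longrightarrow>
              \<bar>pagd_threshold smin smax (a_coeff M j)\<bar>
                \<le> F smin smax M * (smax / smin * ln (real j)))))"
proof (intro conjI allI impI)
  fix T zhat
  assume T: "pagd_threshold (sigma_min A) (sigma_max A) (a_coeff L k) \<le> real T"
    and out: "pagd_output A V L k (G xhat) zprev T zhat"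
  have c: "0 < a_coeff L k" using k L by (simp add: a_coeff_eq)
  have zp: "snd zprev \<in> V" using pts X by auto
  note correct = pagd_output_correct[OF V(2,3) zp c T out]
  show "zhat \<in> X" using correct(1)[of zprev] zp X by (cases zhat) auto
  show "\<forall>z\<in>X.
      a_coeff L k *
        ((G xhat + Q_op A zprev
          + (Q_op A (zhat - zprev) + (2 / a_coeff L k) *\<^sub>R (zhat - zprev))) \<bullet> (zhat - z))
      - 1/2 * ((norm (zhat - zprev))\<^sup>2 + (norm (zhat - z))\<^sup>2) \<le> 0"
  proof
    fix z assume "z \<in> X"
    then have "snd z \<in> V" using X by auto
    then show "a_coeff L k *
        ((G xhat + Q_op A zprev
          + (Q_op A (zhat - zprev) + (2 / a_coeff L k) *\<^sub>R (zhat - zprev))) \<bullet> (zhat - z))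
      - 1/2 * ((norm (zhat - zprev))\<^sup>2 + (norm (zhat - z))\<^sup>2) \<le> 0"
      by (rule correct(2))
  qed
next
  define P where "P p = 42 * (fst p + fst (snd p) + snd (snd p))" for p :: "real \<times> real \<times> real"
  define F where "F smin smax M = P (1 + \<bar>ln smin\<bar>, 1 + \<bar>ln smax\<bar>, 1 + \<bar>ln M\<bar>)"
    for smin smax M :: real
  have "real_polynomial_function P"
    unfolding P_def[abs_def]
    by (intro real_polynomial_function.intros bounded_linear_fst bounded_linear_snd
        bounded_linear_compose[OF bounded_linear_fst] bounded_linear_compose[OF bounded_linear_snd])
  moreover have "\<bar>pagd_threshold smin smax (a_coeff M j)\<bar> \<le> F smin smax M * (smax / smin * ln (real j))"
    if "0 < smin" "smin \<le> smax" "0 < M" "2 \<le> j" for smin smax M :: real and j :: nat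
    using pagd_threshold_upper[OF that] by (simp add: F_def P_def)
  ultimately show "\<exists>(F :: real \<Rightarrow> real \<Rightarrow> real \<Rightarrow> real) (P :: real \<times> real \<times> real \<Rightarrow> real).
        real_polynomial_function P \<and>
        (\<forall>smin smax M :: real. 0 < smin \<and> smin \<le> smax \<and> 0 < M \<longrightarrow>
           F smin smax M \<le> P (1 + \<bar>ln smin\<bar>, 1 + \<bar>ln smax\<bar>, 1 + \<bar>ln M\<bar>) \<and>
           (\<forall>j::nat. 2 \<le> j \<longrightarrow>
              \<bar>pagd_threshold smin smax (a_coeff M j)\<bar>
                \<le> F smin smax M * (smax / smin * ln (real j))))"
    by (intro exI[of _ F] exI[of _ P]) (auto simp: F_def)
qed

end
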